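(* For each integer $J\ge0$ and $\ell\ge1$, provided $u\ge\ell$, \[ K_{\ell}(u)=\sum_{j=0}^{J}\sum_{m=0}^{\ell}\sum_{r=0}^{\ell-m}\frac{(-1)^{r}}{m!\,(\ell-m-r)!}E_{j,m}C_{r}\left(\log^{\ell-m-r}u\right)^{(j)}+O_{J,\ell}\!\left(\frac{\log^{\ell}(eu)}{u^{J+1}}\right), \] where the implied constant depends only on $J$ and $\ell$.
   Context: For an integer $\ell\ge1$ and real $u>0$, \[ K_{\ell}(u):=\frac{1}{\ell!}\int\cdots\int_{\substack{t_{1},\ldots,t_{\ell}\ge1\\ t_{1}+\cdots+t_{\ell}\le u}}\frac{dt_{1}}{t_{1}}\cdots\frac{dt_{\ell}}{t_{\ell}}. \] The constants $C_r$ ($r\ge0$) are defined by the generating function $\sum_{r\ge0}C_r z^r=e^{\gamma z}/\Gamma(1-z)$, where $\gamma$ is Euler's constant. The constants $E_{j,m}$ ($j,m\ge0$) are defined by $\sum_{j\ge0}E_{j,m}z^j=\left(\int_0^z\frac{1-e^{-t}}{t}\,dt\right)^m$. The notation $\left(\log^{k}u\right)^{(j)}$ denotes the $j$-th derivative with respect to $u$ of $(\log u)^k$ (for $k=0$ this is the constant $1$ when $j=0$ and $0$ when $j\ge1$). *)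

theory Defs
  imports "HOL-Analysis.Analysis"
begin

definition K :: "nat \<Rightarrow> real \<Rightarrow> real" where
  "K l u = (1 / fact l) *
     (LINT t : {t \<in> PiE {..<l} (\<lambda>_. UNIV). (\<forall>i<l. 1 \<le> t i) \<and> (\<Sum>i<l. t i) \<le> u}
        | PiM {..<l} (\<lambda>_. lborel). (\<Prod>i<l. 1 / t i))"

definition Cc :: "nat \<Rightarrow> real" where
  "Cc r = (deriv ^^ r) (\<lambda>z::real. exp (euler_mascheroni * z) * rGamma (1 - z)) 0 / fact r"

definition E :: "nat \<Rightarrow> nat \<Rightarrow> real" where
  "E j m = (deriv ^^ j) (\<lambda>z::real. (LBINT t=0..z. (1 - exp (- t)) / t) ^ m) 0 / fact j"

end

theory Submission
  imports Defs
begin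

text \<open>
  Integrating \<open>(t\<^sub>1 + \<dots> + t\<^sub>l) / S\<close> with \<open>S = t\<^sub>1 + \<dots> + t\<^sub>l\<close> instead of \<open>1\<close> cancels one weight and gives
  the delay equation \<open>u K\<^sub>l'(u) = K\<^sub>l\<^sub>-\<^sub>1(u - 1)\<close>. The claimed expansion satisfies the same equation up
  to an error of the right size: with \<open>D = d/du\<close> and \<open>Ein(z) = \<integral>\<^sub>0\<^sup>z (1 - e\<^sup>-\<^sup>t)/t dt\<close> it is the
  truncation of \<open>\<Sum>\<^sub>m Ein(D)\<^sup>m/m! Q\<^sub>l\<^sub>-\<^sub>m\<close>, where \<open>Q\<^sub>k\<close> is a polynomial in \<open>ln u\<close> with
  \<open>u D Q\<^sub>k = Q\<^sub>k\<^sub>-\<^sub>1\<close>, and \<open>z Ein'(z) = 1 - e\<^sup>-\<^sup>z\<close>. By induction on \<open>l\<close> the difference of \<open>K\<^sub>l\<close> and its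
  expansion is therefore a constant plus the claimed error.

  The constant vanishes by comparing Laplace transforms as \<open>s \<rightarrow> 0\<close>: that of \<open>K\<^sub>l\<close> is
  \<open>E\<^sub>1(s)\<^sup>l/l!\<close> with \<open>E\<^sub>1(s) = \<integral>\<^sub>1\<^sup>\<infinity> e\<^sup>-\<^sup>s\<^sup>t/t dt = - \<gamma> - ln s + o(1)\<close>, and the constants
  \<open>C\<^sub>r\<close> are exactly those for which \<open>Q\<^sub>l\<close> has transform \<open>(- \<gamma> - ln s)\<^sup>l/l!\<close>.
\<close>

subsection \<open>The delay equation for \<open>K\<close>\<close>

definition reciprocal_weight :: "real \<Rightarrow> ennreal" where
  "reciprocal_weight t = ennreal (1 / t) * indicator {1..} t"

text \<open>The integral of \<open>f\<close> against the \<open>n\<close>-fold additive convolution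
  power of dt/t on [1, \<infinity>). Values in \<open>ennreal\<close> make Fubini and linearity free
  of integrability conditions.\<close>

definition weighted_sum_integral :: "nat \<Rightarrow> (real \<Rightarrow> ennreal) \<Rightarrow> ennreal" where
  "weighted_sum_integral n f =
     (\<integral>\<^sup>+ x. f (\<Sum>i<n. x i) * (\<Prod>i<n. reciprocal_weight (x i)) \<partial>PiM {..<n} (\<lambda>_. lborel))"

interpretation lborel_power: product_sigma_finite "\<lambda>_::nat. lborel :: real measure"
  by standard

lemma lborel_power_pair: "pair_sigma_finite (PiM {..<n::nat} (\<lambda>_. lborel :: real measure)) (lborel :: real measure)"
  by (intro pair_sigma_finite.intro lborel_power.sigma_finite lborel.sigma_finite_measure_axioms) auto

lemma measurable_reciprocal_weight [measurable]: "reciprocal_weight \<in> borel_measurable borel"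
  unfolding reciprocal_weight_def by measurable

lemma measurable_weighted_sum_integral [measurable]:
  assumes [measurable]: "case_prod f \<in> borel_measurable (N \<Otimes>\<^sub>M borel)"
  shows "(\<lambda>t. weighted_sum_integral n (f t)) \<in> borel_measurable N"
proof -
  interpret sigma_finite_measure "PiM {..<n} (\<lambda>_. lborel :: real measure)"
    by (intro lborel_power.sigma_finite) auto
  show ?thesis
    unfolding weighted_sum_integral_def by measurable
qed

lemma weighted_sum_integral_0: "weighted_sum_integral 0 f = f 0"
  by (simp add: weighted_sum_integral_def PiM_empty nn_integral_count_space_finite)

lemma weighted_sum_integral_Suc:
  assumes [measurable]: "f \<in> borel_measurable borel"
  shows "weighted_sum_integral (Suc n) f =
    (\<integral>\<^sup>+ t. reciprocal_weight t * weighted_sum_integral n (\<lambda>x. f (x + t)) \<partial>lborel)"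
proof -
  have "weighted_sum_integral (Suc n) f =
    (\<integral>\<^sup>+ x. f (\<Sum>i<Suc n. x i) * (\<Prod>i<Suc n. reciprocal_weight (x i)) \<partial>PiM (insert n {..<n}) (\<lambda>_. lborel))"
    unfolding weighted_sum_integral_def lessThan_Suc ..
  also have "\<dots> = (\<integral>\<^sup>+ t. \<integral>\<^sup>+ x. f ((\<Sum>i<n. x i) + t) *
      ((\<Prod>i<n. reciprocal_weight (x i)) * reciprocal_weight t) \<partial>PiM {..<n} (\<lambda>_. lborel) \<partial>lborel)"
    by (subst lborel_power.product_nn_integral_insert_rev) (auto intro!: nn_integral_cong)
  also have "\<dots> = (\<integral>\<^sup>+ t. reciprocal_weight t * weighted_sum_integral n (\<lambda>x. f (x + t)) \<partial>lborel)"
    unfolding weighted_sum_integral_def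
    by (intro nn_integral_cong, subst nn_integral_cmult [symmetric])
       (auto intro!: nn_integral_cong simp: mult_ac)
  finally show ?thesis .
qed

text \<open>The weights vanish unless every coordinate is at least 1, so only sums from
  \<open>n\<close> upwards are seen. This later permits dividing by the sum and splitting
  \<open>ennreal\<close> of a sum.\<close>

lemma weighted_sum_integral_cong:
  assumes "\<And>x. real n \<le> x \<Longrightarrow> f x = g x"
  shows "weighted_sum_integral n f = weighted_sum_integral n g"
  unfolding weighted_sum_integral_def
proof (intro nn_integral_cong)
  fix x :: "nat \<Rightarrow> real"
  show "f (\<Sum>i<n. x i) * (\<Prod>i<n. reciprocal_weight (x i)) =
        g (\<Sum>i<n. x i) * (\<Prod>i<n. reciprocal_weight (x i))"
  proof (cases "\<forall>i<n. 1 \<le> x i")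
    case True
    hence "(\<Sum>i<n. 1) \<le> (\<Sum>i<n. x i)"
      by (intro sum_mono) auto
    thus ?thesis by (simp add: assms)
  next
    case False
    then obtain i where "i < n" "\<not> 1 \<le> x i" by auto
    hence "(\<Prod>i<n. reciprocal_weight (x i)) = 0"
      by (intro prod_zero) (auto simp: reciprocal_weight_def indicator_def)
    thus ?thesis by (simp only: mult_zero_right)
  qed
qed

lemma weighted_sum_integral_add:
  assumes [measurable]: "f \<in> borel_measurable borel" "g \<in> borel_measurable borel"
  shows "weighted_sum_integral n (\<lambda>x. f x + g x) = weighted_sum_integral n f + weighted_sum_integral n g"
  unfolding weighted_sum_integral_def distrib_right by (subst nn_integral_add) auto

lemma weighted_sum_integral_cmult:
  assumes [measurable]: "f \<in> borel_measurable borel"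
  shows "weighted_sum_integral n (\<lambda>x. c * f x) = c * weighted_sum_integral n f"
  unfolding weighted_sum_integral_def mult.assoc by (subst nn_integral_cmult) auto

lemma weighted_sum_integral_Fubini:
  fixes f :: "real \<Rightarrow> real \<Rightarrow> ennreal"
  assumes [measurable]: "case_prod f \<in> borel_measurable (borel \<Otimes>\<^sub>M borel)"
  shows "(\<integral>\<^sup>+ t. weighted_sum_integral n (f t) \<partial>lborel) =
         weighted_sum_integral n (\<lambda>x. \<integral>\<^sup>+ t. f t x \<partial>lborel)"
proof -
  interpret pair_sigma_finite "PiM {..<n} (\<lambda>_. lborel :: real measure)" "lborel :: real measure"
    by (rule lborel_power_pair)
  show ?thesis
    unfolding weighted_sum_integral_def
    by (subst Fubini') (auto simp: nn_integral_multc)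
qed

text \<open>Each of the \<open>n\<close> coordinates making up x cancels its own weight and leaves
  Lebesgue measure on [1, \<infinity>); the factor \<open>n\<close> counts these equal
  contributions. Induction peels off the last coordinate in place of a symmetry argument. For
  \<open>n = 0\<close> both sides are 0, so the truncated \<open>n - 1\<close> does no harm.\<close>

lemma weighted_sum_integral_times_ident:
  assumes "f \<in> borel_measurable borel"
  shows "weighted_sum_integral n (\<lambda>x. ennreal x * f x) =
    of_nat n * (\<integral>\<^sup>+ t. indicator {1..} t * weighted_sum_integral (n - 1) (\<lambda>x. f (x + t)) \<partial>lborel)"
  using assms
proof (induction n arbitrary: f)
  case 0
  thus ?case by (simp add: weighted_sum_integral_0)
next
  case (Suc n)
  note [measurable] = Suc.prems
  \<comment> \<open>\<open>ennreal\<close> is additive on nonnegative reals only; the congruence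
    lemma supplies x \<ge> n.\<close>
  have split: "weighted_sum_integral n (\<lambda>x. ennreal (x + t) * f (x + t)) =
     weighted_sum_integral n (\<lambda>x. ennreal x * f (x + t)) +
     ennreal t * weighted_sum_integral n (\<lambda>x. f (x + t))" if "t \<ge> 1" for t
  proof -
    have "weighted_sum_integral n (\<lambda>x. ennreal (x + t) * f (x + t)) =
          weighted_sum_integral n (\<lambda>x. ennreal x * f (x + t) + ennreal t * f (x + t))"
      using that by (intro weighted_sum_integral_cong) (simp add: ennreal_plus distrib_right)
    thus ?thesis
      by (simp add: weighted_sum_integral_add weighted_sum_integral_cmult)
  qed
  have "weighted_sum_integral (Suc n) (\<lambda>x. ennreal x * f x) =
    (\<integral>\<^sup>+ t. reciprocal_weight t * weighted_sum_integral n (\<lambda>x. ennreal (x + t) * f (x + t)) \<partial>lborel)"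
    by (subst weighted_sum_integral_Suc) auto
  also have "\<dots> = (\<integral>\<^sup>+ t. reciprocal_weight t * weighted_sum_integral n (\<lambda>x. ennreal x * f (x + t)) +
       indicator {1..} t * weighted_sum_integral n (\<lambda>x. f (x + t)) \<partial>lborel)"
  proof (intro nn_integral_cong)
    fix t :: real
    show "reciprocal_weight t * weighted_sum_integral n (\<lambda>x. ennreal (x + t) * f (x + t)) =
      reciprocal_weight t * weighted_sum_integral n (\<lambda>x. ennreal x * f (x + t)) +
       indicator {1..} t * weighted_sum_integral n (\<lambda>x. f (x + t))"
    proof (cases "t \<ge> 1")
      case True
      hence "ennreal (1 / t) * ennreal t = 1"
        by (simp flip: ennreal_mult)
      hence "ennreal (1 / t) * (ennreal t * w) = w" for w
        by (simp flip: mult.assoc)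
      thus ?thesis using True
        by (simp add: split reciprocal_weight_def distrib_left)
    qed (simp add: reciprocal_weight_def)
  qed
  also have "\<dots> = (\<integral>\<^sup>+ t. reciprocal_weight t * weighted_sum_integral n (\<lambda>x. ennreal x * f (x + t)) \<partial>lborel) +
       (\<integral>\<^sup>+ t. indicator {1..} t * weighted_sum_integral n (\<lambda>x. f (x + t)) \<partial>lborel)"
    by (intro nn_integral_add) auto
  also have "(\<integral>\<^sup>+ t. reciprocal_weight t * weighted_sum_integral n (\<lambda>x. ennreal x * f (x + t)) \<partial>lborel) =
     of_nat n * (\<integral>\<^sup>+ t. indicator {1..} t * weighted_sum_integral n (\<lambda>x. f (x + t)) \<partial>lborel)"
  proof (cases n)
    case 0
    thus ?thesis by (simp add: weighted_sum_integral_0)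
  next
    case n: (Suc k)
    have "(\<integral>\<^sup>+ t. reciprocal_weight t * weighted_sum_integral n (\<lambda>x. ennreal x * f (x + t)) \<partial>lborel) =
       (\<integral>\<^sup>+ t. reciprocal_weight t * (of_nat n *
          (\<integral>\<^sup>+ s. indicator {1..} s * weighted_sum_integral k (\<lambda>x. f (x + s + t)) \<partial>lborel)) \<partial>lborel)"
      by (subst Suc.IH) (simp_all add: n)
    also have "\<dots> = of_nat n * (\<integral>\<^sup>+ t. \<integral>\<^sup>+ s. reciprocal_weight t *
       (indicator {1..} s * weighted_sum_integral k (\<lambda>x. f (x + s + t))) \<partial>lborel \<partial>lborel)"
      by (subst nn_integral_cmult [symmetric], measurable, intro nn_integral_cong,
          subst nn_integral_cmult, measurable, simp add: mult_ac)
    \<comment> \<open>After the swap the weighted variable t joins the other \<open>k\<close>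
      coordinates and restores the \<open>n\<close>-fold integral.\<close>
    also have "(\<integral>\<^sup>+ t. \<integral>\<^sup>+ s. reciprocal_weight t *
       (indicator {1..} s * weighted_sum_integral k (\<lambda>x. f (x + s + t))) \<partial>lborel \<partial>lborel) =
       (\<integral>\<^sup>+ s. \<integral>\<^sup>+ t. reciprocal_weight t *
       (indicator {1..} s * weighted_sum_integral k (\<lambda>x. f (x + s + t))) \<partial>lborel \<partial>lborel)"
      by (rule lborel_pair.Fubini') measurable
    also have "\<dots> = (\<integral>\<^sup>+ s. indicator {1..} s * weighted_sum_integral n (\<lambda>x. f (x + s)) \<partial>lborel)"
      unfolding n
      by (intro nn_integral_cong, subst weighted_sum_integral_Suc, measurable,
          subst nn_integral_cmult [symmetric], measurable, intro nn_integral_cong)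
         (simp add: add_ac mult_ac)
    finally show ?thesis .
  qed
  finally show ?case
    by (simp add: distrib_right add.commute)
qed


text \<open>Integrated form of the delay equation. Take f(x) = 1/x up to u in the preceding identity
  and let v be the whole sum: the coordinate freed of its weight is v - x, and v - x \<ge> 1 becomes
  x \<le> v - 1.\<close>

lemma weighted_sum_integral_atMost_Suc:
  "weighted_sum_integral (Suc n) (indicator {..u}) =
    of_nat (Suc n) * (\<integral>\<^sup>+ v. ennreal (1 / v) * indicator {0<..u} v *
      weighted_sum_integral n (indicator {..v - 1}) \<partial>lborel)"
proof -
  define f where "f = (\<lambda>x. ennreal (1 / x) * indicator {0<..u} x)"
  have f [measurable]: "f \<in> borel_measurable borel"
    unfolding f_def by measurable
  have [measurable]: "(\<lambda>(t, x). indicator {1..} (t - x) * f t :: ennreal) \<in> borel_measurable (borel \<Otimes>\<^sub>M borel)"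
    by measurable
  have "weighted_sum_integral (Suc n) (indicator {..u}) = weighted_sum_integral (Suc n) (\<lambda>x. ennreal x * f x)"
  proof (rule weighted_sum_integral_cong)
    fix x assume "real (Suc n) \<le> x"
    hence x: "x > 0" by linarith
    hence "ennreal x * ennreal (1 / x) = 1"
      by (simp flip: ennreal_mult)
    thus "indicator {..u} x = ennreal x * f x"
      using x by (simp add: f_def indicator_def)
  qed
  also have "\<dots> = of_nat (Suc n) *
      (\<integral>\<^sup>+ t. indicator {1..} t * weighted_sum_integral n (\<lambda>x. f (x + t)) \<partial>lborel)"
    by (subst weighted_sum_integral_times_ident) auto
  also have "(\<integral>\<^sup>+ t. indicator {1..} t * weighted_sum_integral n (\<lambda>x. f (x + t)) \<partial>lborel) =
      (\<integral>\<^sup>+ t. weighted_sum_integral n (\<lambda>x. indicator {1..} t * f (x + t)) \<partial>lborel)"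
    by (simp add: weighted_sum_integral_cmult)
  also have "\<dots> = weighted_sum_integral n (\<lambda>x. \<integral>\<^sup>+ t. indicator {1..} t * f (x + t) \<partial>lborel)"
    by (rule weighted_sum_integral_Fubini) measurable
  also have "\<dots> = weighted_sum_integral n (\<lambda>x. \<integral>\<^sup>+ t. indicator {1..} (t - x) * f t \<partial>lborel)"
  proof (rule weighted_sum_integral_cong)
    fix x :: real
    have "(\<integral>\<^sup>+ t. indicator {1..} (t - x) * f t \<partial>lborel) =
      ennreal \<bar>1\<bar> * (\<integral>\<^sup>+ t. indicator {1..} (x + 1 * t - x) * f (x + 1 * t) \<partial>lborel)"
      by (rule nn_integral_real_affine) measurable
    thus "(\<integral>\<^sup>+ t. indicator {1..} t * f (x + t) \<partial>lborel) = (\<integral>\<^sup>+ t. indicator {1..} (t - x) * f t \<partial>lborel)"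
      by simp
  qed
  also have "\<dots> = (\<integral>\<^sup>+ t. weighted_sum_integral n (\<lambda>x. indicator {1..} (t - x) * f t) \<partial>lborel)"
    by (rule weighted_sum_integral_Fubini [symmetric]) measurable
  also have "\<dots> = (\<integral>\<^sup>+ t. f t * weighted_sum_integral n (indicator {..t - 1}) \<partial>lborel)"
  proof (intro nn_integral_cong)
    fix t :: real
    have "weighted_sum_integral n (\<lambda>x. indicator {1..} (t - x) * f t) =
          weighted_sum_integral n (\<lambda>x. f t * indicator {..t - 1} x)"
      by (intro weighted_sum_integral_cong) (auto simp: indicator_def)
    thus "weighted_sum_integral n (\<lambda>x. indicator {1..} (t - x) * f t) =
          f t * weighted_sum_integral n (indicator {..t - 1})"
      by (simp add: weighted_sum_integral_cmult)
  qed
  finally show ?thesis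
    unfolding f_def .
qed

text \<open>Solution of the delay equation by successive integration. The integral starts at
  \<open>Suc n\<close> because \<open>delay_K n (v - 1)\<close> is 0 before that; for smaller u the
  interval is empty and the value is 0.\<close>

fun delay_K :: "nat \<Rightarrow> real \<Rightarrow> real" where
  "delay_K 0 u = (if u < 0 then 0 else 1)"
| "delay_K (Suc n) u = integral {real (Suc n)..u} (\<lambda>v. delay_K n (v - 1) / v)"

lemma delay_K_Suc: "delay_K (Suc n) = (\<lambda>u. integral {real (Suc n)..u} (\<lambda>v. delay_K n (v - 1) / v))"
  by (rule ext) simp

lemma delay_K_eq_0: "u < real n \<Longrightarrow> delay_K n u = 0"
  by (cases n) auto

text \<open>The ray starts at \<open>n\<close> because \<open>delay_K 0\<close> jumps at 0; on the
  shifted ray the integrand of the next step is continuous.\<close>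

lemma continuous_on_delay_K: "continuous_on {real n..} (delay_K n)"
proof (induction n)
  case 0
  have "continuous_on {real 0..} (\<lambda>_. 1 :: real)" by simp
  thus ?case by (rule continuous_on_eq) auto
next
  case (Suc n)
  have int: "(\<lambda>v. delay_K n (v - 1) / v) integrable_on {real (Suc n)..b}" for b
    by (intro integrable_continuous_real continuous_intros continuous_on_compose2 [OF Suc]) auto
  show ?case
    unfolding continuous_on_eq_continuous_within
  proof
    fix u assume u: "u \<in> {real (Suc n)..}"
    \<comment> \<open>Continuity is local, so a compact interval reaching past u suffices.\<close>
    have "continuous_on {real (Suc n)..u + 1} (delay_K (Suc n))"
      by (simp only: delay_K_Suc, rule indefinite_integral_continuous_1 [OF int])
    hence "continuous (at u within {real (Suc n)..u + 1}) (delay_K (Suc n))"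
      using u by (auto simp: continuous_on_eq_continuous_within simp del: delay_K.simps)
    moreover have "at u within {real (Suc n)..u + 1} = at u within {real (Suc n)..}"
      by (rule at_within_nhd [where S = "{u - 1<..<u + 1}"]) auto
    ultimately show "continuous (at u within {real (Suc n)..}) (delay_K (Suc n))"
      by simp
  qed
qed

lemma delay_K_integrand_integrable:
  "(\<lambda>v. delay_K n (v - 1) / v) integrable_on {real (Suc n)..b}"
  by (intro integrable_continuous_real continuous_intros continuous_on_compose2 [OF continuous_on_delay_K])
     auto

lemma delay_K_nonneg: "delay_K n u \<ge> 0"
proof (induction n arbitrary: u)
  case (Suc n)
  thus ?case unfolding delay_K.simps
    by (intro Henstock_Kurzweil_Integration.integral_nonneg delay_K_integrand_integrable) auto
qed simp

lemma has_real_derivative_delay_K: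
  assumes "u > real (Suc n)"
  shows "(delay_K (Suc n) has_real_derivative delay_K n (u - 1) / u) (at u)"
proof -
  have "continuous_on {real (Suc n)..u + 1} (\<lambda>v. delay_K n (v - 1) / v)"
    by (intro continuous_intros continuous_on_compose2 [OF continuous_on_delay_K]) auto
  hence "(delay_K (Suc n) has_real_derivative delay_K n (u - 1) / u) (at u within {real (Suc n)..u + 1})"
    using assms by (simp only: delay_K_Suc, intro integral_has_real_derivative) auto
  moreover have "at u within {real (Suc n)..u + 1} = at u"
    using assms by (intro at_within_interior) auto
  ultimately show ?thesis by simp
qed

lemma borel_measurable_delay_K [measurable]: "delay_K n \<in> borel_measurable borel"
proof -
  have "(\<lambda>x. indicator {real n..} x *\<^sub>R delay_K n x) \<in> borel_measurable borel"
    by (intro borel_measurable_continuous_on_indicator continuous_on_delay_K) auto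
  also have "(\<lambda>x. indicator {real n..} x *\<^sub>R delay_K n x) = delay_K n"
    by (auto simp: indicator_def delay_K_eq_0 fun_eq_iff)
  finally show ?thesis .
qed

text \<open>The factors \<open>Suc n\<close> of the successive delay steps multiply to
  \<open>fact n\<close>, the normalisation in \<open>K\<close>.\<close>

lemma weighted_sum_integral_atMost:
  "weighted_sum_integral n (indicator {..u}) = ennreal (fact n * delay_K n u)"
proof (induction n arbitrary: u)
  case 0
  show ?case by (simp add: weighted_sum_integral_0 indicator_def)
next
  case (Suc n)
  have "(\<integral>\<^sup>+ v. ennreal (1 / v) * indicator {0<..u} v * weighted_sum_integral n (indicator {..v - 1}) \<partial>lborel) =
    (\<integral>\<^sup>+ v. ennreal (fact n) * ennreal (indicator {real (Suc n)..u} v * (delay_K n (v - 1) / v)) \<partial>lborel)"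
  proof (intro nn_integral_cong)
    fix v :: real
    show "ennreal (1 / v) * indicator {0<..u} v * weighted_sum_integral n (indicator {..v - 1}) =
      ennreal (fact n) * ennreal (indicator {real (Suc n)..u} v * (delay_K n (v - 1) / v))"
    \<comment> \<open>Between 0 and \<open>Suc n\<close> the inner integral vanishes, so the two
      domains of integration agree.\<close>
    proof (cases "real (Suc n) \<le> v")
      case True
      hence "v > 0" by linarith
      thus ?thesis using True
        by (auto simp: Suc indicator_def delay_K_nonneg simp flip: ennreal_mult)
    next
      case False
      thus ?thesis by (simp add: Suc delay_K_eq_0)
    qed
  qed
  also have "\<dots> = ennreal (fact n) *
      (\<integral>\<^sup>+ v. ennreal (indicator {real (Suc n)..u} v * (delay_K n (v - 1) / v)) \<partial>lborel)"
    by (rule nn_integral_cmult) measurable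
  also have "(\<integral>\<^sup>+ v. ennreal (indicator {real (Suc n)..u} v * (delay_K n (v - 1) / v)) \<partial>lborel) =
      ennreal (delay_K (Suc n) u)"
  proof (rule nn_integral_has_integral_lebesgue)
    show "((\<lambda>v. delay_K n (v - 1) / v) has_integral delay_K (Suc n) u) {real (Suc n)..u}"
      using delay_K_integrand_integrable[of n u] by (simp add: has_integral_integral)
  qed (auto intro!: divide_nonneg_nonneg delay_K_nonneg)
  finally show ?case
    unfolding weighted_sum_integral_atMost_Suc
    by (simp add: delay_K_nonneg ennreal_mult ennreal_of_nat_eq_real_of_nat mult_ac del: delay_K.simps of_nat_Suc)
qed

lemma K_eq_delay_K: "K l u = delay_K l u"
proof -
  define A where "A = {t \<in> PiE {..<l} (\<lambda>_. UNIV :: real set). (\<forall>i<l. 1 \<le> t i) \<and> (\<Sum>i<l. t i) \<le> u}"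
  have [measurable]: "A \<in> sets (PiM {..<l} (\<lambda>_. lborel))"
  proof -
    have "A = {t \<in> space (PiM {..<l} (\<lambda>_. lborel)). (\<forall>i\<in>{..<l}. 1 \<le> t i) \<and> (\<Sum>i<l. t i) \<le> u}"
      by (auto simp: A_def space_PiM)
    also have "\<dots> \<in> sets (PiM {..<l} (\<lambda>_. lborel))" by measurable
    finally show ?thesis .
  qed
  \<comment> \<open>The integrand is nonnegative, so its Bochner integral can be read off from the
    \<open>ennreal\<close> integral before finiteness is known.\<close>
  have "(LINT t : A | PiM {..<l} (\<lambda>_. lborel). (\<Prod>i<l. 1 / t i)) =
     enn2real (\<integral>\<^sup>+ t. ennreal (indicator A t *\<^sub>R (\<Prod>i<l. 1 / t i)) \<partial>PiM {..<l} (\<lambda>_. lborel))"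
    unfolding set_lebesgue_integral_def
    by (intro integral_eq_nn_integral) (auto simp: indicator_def A_def intro!: AE_I2 prod_nonneg divide_nonneg_nonneg dest: order_trans [OF zero_le_one])
  also have "(\<integral>\<^sup>+ t. ennreal (indicator A t *\<^sub>R (\<Prod>i<l. 1 / t i)) \<partial>PiM {..<l} (\<lambda>_. lborel)) =
     weighted_sum_integral l (indicator {..u})"
    unfolding weighted_sum_integral_def
  proof (intro nn_integral_cong)
    fix t :: "nat \<Rightarrow> real"
    assume t: "t \<in> space (PiM {..<l} (\<lambda>_. lborel))"
    show "ennreal (indicator A t *\<^sub>R (\<Prod>i<l. 1 / t i)) =
      indicator {..u} (\<Sum>i<l. t i) * (\<Prod>i<l. reciprocal_weight (t i))"
    proof (cases "\<forall>i<l. 1 \<le> t i")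
      case True
      have "(\<Prod>i<l. reciprocal_weight (t i)) = (\<Prod>i<l. ennreal (1 / t i))"
        using True by (intro prod.cong) (auto simp: reciprocal_weight_def)
      also have "\<dots> = ennreal (\<Prod>i<l. 1 / t i)"
        using True by (intro prod_ennreal) (auto dest!: spec intro: order_trans [OF zero_le_one])
      finally show ?thesis using t True
        by (auto simp: A_def indicator_def space_PiM)
    next
      case False
      then obtain i where "i < l" "\<not> 1 \<le> t i" by auto
      hence "(\<Prod>i<l. reciprocal_weight (t i)) = 0"
        by (intro prod_zero) (auto simp: reciprocal_weight_def indicator_def)
      thus ?thesis using False by (auto simp: A_def)
    qed
  qed
  finally show ?thesis
    by (simp add: K_def A_def weighted_sum_integral_atMost delay_K_nonneg)
qed

subsection \<open>The Laplace transform of \<open>K\<close>\<close>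

text \<open>For s > 0 the integral is finite by \<open>nn_integral_E1\<close>, so
  \<open>enn2real\<close> hides no infinite value there.\<close>

definition exp_integral_E1 :: "real \<Rightarrow> real" where
  "exp_integral_E1 s = enn2real (\<integral>\<^sup>+ t. reciprocal_weight t * ennreal (exp (- s * t)) \<partial>lborel)"

lemma nn_integral_exp_atLeast:
  assumes "s > 0"
  shows "(\<integral>\<^sup>+ u. ennreal (s * exp (- s * u)) * indicator {x..} u \<partial>lborel) = ennreal (exp (- s * x))"
proof -
  have "(\<integral>\<^sup>+ u. ennreal (s * exp (- s * u)) * indicator {x..} u \<partial>lborel) = 0 - (- exp (- s * x))"
  proof (rule nn_integral_FTC_atLeast)
    have "filterlim (\<lambda>u. s * u) at_top at_top"
      using assms by (intro filterlim_tendsto_pos_mult_at_top [OF tendsto_const]) (auto intro: filterlim_ident)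
    hence "((\<lambda>u. exp (- (s * u))) \<longlongrightarrow> 0) at_top"
      by (intro filterlim_compose [OF exp_at_bot] filterlim_compose [OF filterlim_uminus_at_bot_at_top])
    thus "((\<lambda>u. - exp (- s * u)) \<longlongrightarrow> 0) at_top"
      using tendsto_minus by fastforce
  qed (use assms in \<open>auto intro!: derivative_eq_intros\<close>)
  thus ?thesis by simp
qed

lemma nn_integral_E1:
  assumes "s > 0"
  shows "(\<integral>\<^sup>+ t. reciprocal_weight t * ennreal (exp (- s * t)) \<partial>lborel) = ennreal (exp_integral_E1 s)"
proof -
  have "(\<integral>\<^sup>+ t. reciprocal_weight t * ennreal (exp (- s * t)) \<partial>lborel) \<le>
        (\<integral>\<^sup>+ t. ennreal (1 / s) * (ennreal (s * exp (- s * t)) * indicator {1..} t) \<partial>lborel)"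
    using assms by (intro nn_integral_mono)
      (auto simp: reciprocal_weight_def indicator_def field_simps simp flip: ennreal_mult)
  also have "\<dots> = ennreal (1 / s) * ennreal (exp (- s * 1))"
    by (subst nn_integral_cmult, measurable, simp only: nn_integral_exp_atLeast [OF assms])
  also have "\<dots> < top" by (simp add: ennreal_mult_less_top)
  finally show ?thesis by (simp add: exp_integral_E1_def)
qed

text \<open>The exponential turns sums into products, so the transform of a convolution power is a
  power.\<close>

lemma weighted_sum_integral_exp:
  assumes "s > 0"
  shows "weighted_sum_integral n (\<lambda>x. ennreal (exp (- s * x))) = ennreal (exp_integral_E1 s) ^ n"
proof (induction n)
  case 0
  thus ?case by (simp add: weighted_sum_integral_0)
next
  case (Suc n)
  have "weighted_sum_integral (Suc n) (\<lambda>x. ennreal (exp (- s * x))) =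
    (\<integral>\<^sup>+ t. reciprocal_weight t * weighted_sum_integral n (\<lambda>x. ennreal (exp (- s * (x + t)))) \<partial>lborel)"
    by (rule weighted_sum_integral_Suc) measurable
  also have "(\<lambda>t. weighted_sum_integral n (\<lambda>x. ennreal (exp (- s * (x + t))))) =
    (\<lambda>t. ennreal (exp (- s * t)) * ennreal (exp_integral_E1 s) ^ n)"
    by (subst Suc.IH [symmetric], subst weighted_sum_integral_cmult [symmetric])
       (auto simp: algebra_simps simp flip: ennreal_mult exp_add)
  also have "(\<integral>\<^sup>+ t. reciprocal_weight t * (ennreal (exp (- s * t)) * ennreal (exp_integral_E1 s) ^ n) \<partial>lborel) =
    ennreal (exp_integral_E1 s) * ennreal (exp_integral_E1 s) ^ n"
    by (subst nn_integral_E1 [OF assms, symmetric], subst nn_integral_multc [symmetric])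
       (auto simp: mult.assoc)
  finally show ?case by simp
qed

text \<open>By Fubini each point x of the convolution power contributes the integral of
  \<open>s * exp (- s * u)\<close> over u \<ge> x, which is \<open>exp (- s * x)\<close>. The factor
  s makes constants their own transforms.\<close>

lemma Laplace_transform_K:
  assumes "s > 0"
  shows "has_bochner_integral lborel (\<lambda>u. indicator {0<..} u * (s * exp (- s * u) * K n u))
           (exp_integral_E1 s ^ n / fact n)"
proof (rule has_bochner_integral_nn_integral)
  have K_nonneg: "K n u \<ge> 0" for u
    by (simp add: K_eq_delay_K delay_K_nonneg)
  have [measurable]: "K n \<in> borel_measurable borel"
  proof -
    have "K n = delay_K n" by (simp add: K_eq_delay_K fun_eq_iff)
    thus ?thesis by simp
  qed
  show "(\<lambda>u. indicator {0<..} u * (s * exp (- s * u) * K n u)) \<in> borel_measurable lborel"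
    by measurable
  show "AE u in lborel. 0 \<le> indicator {0<..} u * (s * exp (- s * u) * K n u)"
    using assms by (auto simp: K_nonneg)
  show "0 \<le> exp_integral_E1 s ^ n / fact n"
    by (simp add: exp_integral_E1_def)
  \<comment> \<open>The factor \<open>fact n\<close> matches \<open>fact n * K n u\<close> in
    \<open>weighted_sum_integral_atMost\<close>; it is cancelled at the end.\<close>
  have "ennreal (fact n) * (\<integral>\<^sup>+ u. ennreal (indicator {0<..} u * (s * exp (- s * u) * K n u)) \<partial>lborel) =
    (\<integral>\<^sup>+ u. ennreal (fact n) * ennreal (indicator {0<..} u * (s * exp (- s * u) * K n u)) \<partial>lborel)"
    by (rule nn_integral_cmult [symmetric]) measurable
  also have "\<dots> = (\<integral>\<^sup>+ u. weighted_sum_integral n (\<lambda>x. ennreal (s * exp (- s * u)) * indicator {0<..} u *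
      indicator {0..} (u - x)) \<partial>lborel)"
  proof (intro nn_integral_cong)
    fix u :: real
    have "weighted_sum_integral n (\<lambda>x. ennreal (s * exp (- s * u)) * indicator {0<..} u *
      indicator {0..} (u - x)) = weighted_sum_integral n (\<lambda>x. (ennreal (s * exp (- s * u)) * indicator {0<..} u) *
      indicator {..u} x)"
      by (intro weighted_sum_integral_cong) (auto simp: indicator_def)
    also have "\<dots> = (ennreal (s * exp (- s * u)) * indicator {0<..} u) * ennreal (fact n * K n u)"
      by (subst weighted_sum_integral_cmult) (auto simp: weighted_sum_integral_atMost K_eq_delay_K)
    also have "\<dots> = ennreal (fact n) * ennreal (indicator {0<..} u * (s * exp (- s * u) * K n u))"
      using assms by (auto simp: indicator_def K_nonneg mult_ac simp flip: ennreal_mult)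
    finally show "ennreal (fact n) * ennreal (indicator {0<..} u * (s * exp (- s * u) * K n u)) = 
      weighted_sum_integral n (\<lambda>x. ennreal (s * exp (- s * u)) * indicator {0<..} u * indicator {0..} (u - x))"
      by simp
  qed
  also have "\<dots> = weighted_sum_integral n (\<lambda>x. \<integral>\<^sup>+ u. ennreal (s * exp (- s * u)) * indicator {0<..} u *
      indicator {0..} (u - x) \<partial>lborel)"
    by (rule weighted_sum_integral_Fubini) measurable
  also have "\<dots> = weighted_sum_integral n (\<lambda>x. ennreal (exp (- s * x)))"
  proof (rule weighted_sum_integral_cong)
    fix x assume "real n \<le> x"
    have "(\<integral>\<^sup>+ u. ennreal (s * exp (- s * u)) * indicator {0<..} u * indicator {0..} (u - x) \<partial>lborel) =
          (\<integral>\<^sup>+ u. ennreal (s * exp (- s * u)) * indicator {x..} u \<partial>lborel)"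
    proof (rule nn_integral_cong_AE)
      \<comment> \<open>The two domains differ at most in the point u = 0, and only if x =
        0.\<close>
      show "AE u in lborel. ennreal (s * exp (- s * u)) * indicator {0<..} u * indicator {0..} (u - x) =
         ennreal (s * exp (- s * u)) * indicator {x..} u"
        using AE_lborel_singleton[of 0]
        by eventually_elim (use \<open>real n \<le> x\<close> in \<open>auto simp: indicator_def\<close>)
    qed
    thus "(\<integral>\<^sup>+ u. ennreal (s * exp (- s * u)) * indicator {0<..} u * indicator {0..} (u - x) \<partial>lborel) =
      ennreal (exp (- s * x))"
      by (simp only: nn_integral_exp_atLeast [OF assms])
  qed
  also have "\<dots> = ennreal (fact n) * ennreal (exp_integral_E1 s ^ n / fact n)"
    by (subst weighted_sum_integral_exp [OF assms])
       (simp add: exp_integral_E1_def ennreal_power flip: ennreal_mult)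
  finally show "(\<integral>\<^sup>+ u. ennreal (indicator {0<..} u * (s * exp (- s * u) * K n u)) \<partial>lborel) =
      ennreal (exp_integral_E1 s ^ n / fact n)"
    by (subst (asm) ennreal_mult_cancel_left) auto
qed

subsection \<open>Derivatives of powers of the logarithm\<close>

lemma deriv_cong_pos:
  fixes f g :: "real \<Rightarrow> real"
  assumes "\<And>x. x > 0 \<Longrightarrow> f x = g x" "u > 0"
  shows "deriv f u = deriv g u"
proof (rule deriv_cong_ev)
  have "eventually (\<lambda>x. x \<in> {0<..}) (nhds u)"
    using assms(2) by (intro eventually_nhds_in_open) auto
  thus "eventually (\<lambda>x. f x = g x) (nhds u)"
    by eventually_elim (auto simp: assms(1))
qed simp

text \<open>Differentiating p(ln u)/u^j gives (p' - j p)(ln u)/u^(j+1), and the degree does not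
  grow.\<close>

lemma higher_deriv_ln_power_poly:
  "\<exists>p. degree p \<le> k \<and> (\<forall>u>0. (deriv ^^ j) (\<lambda>x::real. ln x ^ k) u = poly p (ln u) / u ^ j)"
proof (induction j)
  case 0
  show ?case
    by (intro exI[of _ "monom 1 k"]) (auto simp: degree_monom_eq poly_monom)
next
  case (Suc j)
  then obtain p where p: "degree p \<le> k"
    "\<And>u. u > 0 \<Longrightarrow> (deriv ^^ j) (\<lambda>x::real. ln x ^ k) u = poly p (ln u) / u ^ j"
    by blast
  show ?case
  proof (intro exI conjI allI impI)
    show "degree (pderiv p - smult (of_nat j) p) \<le> k"
      using p(1) degree_smult_le[of "of_nat j" p] by (intro degree_diff_le) (auto simp: degree_pderiv)
    fix u :: real assume u: "u > 0"
    have "deriv ((deriv ^^ j) (\<lambda>x::real. ln x ^ k)) u = deriv (\<lambda>u. poly p (ln u) / u ^ j) u"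
      by (rule deriv_cong_pos) (use p(2) u in auto)
    also have "\<dots> = poly (pderiv p - smult (of_nat j) p) (ln u) / u ^ Suc j"
    proof (rule DERIV_imp_deriv)
      have "((\<lambda>u. poly p (ln u) / u ^ j) has_real_derivative
         ((poly (pderiv p) (ln u) * (1 / u)) * u ^ j - poly p (ln u) * (real j * u ^ (j - 1))) / (u ^ j * u ^ j)) (at u)"
        using u by (auto intro!: derivative_eq_intros DERIV_chain2 [OF poly_DERIV])
      moreover have "((poly (pderiv p) (ln u) * (1 / u)) * u ^ j - poly p (ln u) * (real j * u ^ (j - 1))) / (u ^ j * u ^ j) =
         poly (pderiv p - smult (of_nat j) p) (ln u) / u ^ Suc j"
        using u by (cases j) (auto simp: field_simps)
      ultimately show "((\<lambda>u. poly p (ln u) / u ^ j) has_real_derivative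
         poly (pderiv p - smult (of_nat j) p) (ln u) / u ^ Suc j) (at u)"
        by simp
    qed
    finally show "(deriv ^^ Suc j) (\<lambda>x::real. ln x ^ k) u = poly (pderiv p - smult (of_nat j) p) (ln u) / u ^ Suc j"
      by simp
  qed
qed

text \<open>\<open>deriv\<close> is total, so iterating it says nothing about differentiability; the
  closed form of the previous lemma does.\<close>

lemma has_real_derivative_higher_deriv_ln_power:
  assumes "u > 0"
  shows "((deriv ^^ j) (\<lambda>x. ln x ^ k) has_real_derivative (deriv ^^ Suc j) (\<lambda>x. ln x ^ k) u) (at u)"
proof -
  obtain p where p: "\<And>u. u > 0 \<Longrightarrow> (deriv ^^ j) (\<lambda>x::real. ln x ^ k) u = poly p (ln u) / u ^ j"
    using higher_deriv_ln_power_poly by blast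
  have "(\<lambda>u. poly p (ln u) / u ^ j) field_differentiable at u"
    unfolding field_differentiable_def using assms
    by (auto intro!: exI derivative_eq_intros DERIV_chain2 [OF poly_DERIV])
  hence "((\<lambda>u. poly p (ln u) / u ^ j) has_real_derivative deriv (\<lambda>u. poly p (ln u) / u ^ j) u) (at u)"
    by (rule field_differentiable_derivI)
  also have "deriv (\<lambda>u. poly p (ln u) / u ^ j) u = (deriv ^^ Suc j) (\<lambda>x. ln x ^ k) u"
    by (simp, rule deriv_cong_pos) (use p assms in auto)
  finally show ?thesis
    by (rule has_field_derivative_transform_within_open [where S = "{0<..}"]) (use assms p in auto)
qed

text \<open>This is u D (ln^k) = k ln^(k-1) differentiated j times, the factor u producing the extra
  term by the Leibniz rule. For k = 0 the factor k removes the truncated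
  \<open>k - 1\<close>.\<close>

lemma higher_deriv_ln_power_recurrence:
  assumes "u > 0"
  shows "u * (deriv ^^ Suc j) (\<lambda>x. ln x ^ k) u =
    real k * (deriv ^^ j) (\<lambda>x. ln x ^ (k - 1)) u - real j * (deriv ^^ j) (\<lambda>x. ln x ^ k) u"
  using assms
proof (induction j arbitrary: u)
  case 0
  have "((\<lambda>x. ln x ^ k) has_real_derivative real k * ln u ^ (k - 1) / u) (at u)"
    using 0 by (auto intro!: derivative_eq_intros)
  hence "deriv (\<lambda>x. ln x ^ k) u = real k * ln u ^ (k - 1) / u"
    by (rule DERIV_imp_deriv)
  thus ?case using 0 by simp
next
  case (Suc j)
  note [derivative_intros] = has_real_derivative_higher_deriv_ln_power
  let ?L = "\<lambda>j k. (deriv ^^ j) (\<lambda>x::real. ln x ^ k)"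
  have "((\<lambda>u. u * ?L (Suc j) k u) has_real_derivative ?L (Suc j) k u + u * ?L (Suc (Suc j)) k u) (at u)"
    using Suc.prems by (auto intro!: derivative_eq_intros simp del: funpow.simps)
  moreover have "((\<lambda>u. real k * ?L j (k - 1) u - real j * ?L j k u) has_real_derivative
      real k * ?L (Suc j) (k - 1) u - real j * ?L (Suc j) k u) (at u)"
    using Suc.prems by (auto intro!: derivative_eq_intros simp del: funpow.simps)
  hence "((\<lambda>u. u * ?L (Suc j) k u) has_real_derivative
      real k * ?L (Suc j) (k - 1) u - real j * ?L (Suc j) k u) (at u)"
    by (rule has_field_derivative_transform_within_open [where S = "{0<..}"])
       (use Suc in \<open>auto simp del: funpow.simps\<close>)
  ultimately have "?L (Suc j) k u + u * ?L (Suc (Suc j)) k u =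
      real k * ?L (Suc j) (k - 1) u - real j * ?L (Suc j) k u"
    by (rule DERIV_unique)
  thus ?case by (simp add: algebra_simps del: funpow.simps)
qed

text \<open>In base 1 + x \<ge> 1 the k-th power dominates all lower ones; for x = ln u this base is
  the ln(e u) of the theorem.\<close>

lemma abs_poly_le_power:
  fixes p :: "real poly"
  assumes "degree p \<le> k" "x \<ge> 0"
  shows "\<bar>poly p x\<bar> \<le> (\<Sum>i\<le>degree p. \<bar>coeff p i\<bar>) * (1 + x) ^ k"
proof -
  have "\<bar>poly p x\<bar> \<le> (\<Sum>i\<le>degree p. \<bar>coeff p i * x ^ i\<bar>)"
    unfolding poly_altdef by (rule sum_abs)
  also have "\<dots> \<le> (\<Sum>i\<le>degree p. \<bar>coeff p i\<bar> * (1 + x) ^ k)"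
  proof (rule sum_mono)
    fix i assume "i \<in> {..degree p}"
    have "x ^ i \<le> (1 + x) ^ i" using assms by (intro power_mono) auto
    also have "\<dots> \<le> (1 + x) ^ k"
      using assms \<open>i \<in> _\<close> by (intro power_increasing) auto
    finally show "\<bar>coeff p i * x ^ i\<bar> \<le> \<bar>coeff p i\<bar> * (1 + x) ^ k"
      using assms by (simp add: abs_mult mult_left_mono)
  qed
  finally show ?thesis by (simp add: sum_distrib_right)
qed

lemma higher_deriv_ln_power_bound:
  obtains C where "C \<ge> 0"
    "\<And>u. u \<ge> 1 \<Longrightarrow> \<bar>(deriv ^^ j) (\<lambda>x::real. ln x ^ k) u\<bar> \<le> C * (1 + ln u) ^ k / u ^ j"
proof -
  obtain p where p: "degree p \<le> k"
    "\<And>u. u > 0 \<Longrightarrow> (deriv ^^ j) (\<lambda>x::real. ln x ^ k) u = poly p (ln u) / u ^ j"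
    using higher_deriv_ln_power_poly by blast
  show ?thesis
  proof (rule that[of "\<Sum>i\<le>degree p. \<bar>coeff p i\<bar>"])
    fix u :: real assume "u \<ge> 1"
    thus "\<bar>(deriv ^^ j) (\<lambda>x::real. ln x ^ k) u\<bar> \<le> (\<Sum>i\<le>degree p. \<bar>coeff p i\<bar>) * (1 + ln u) ^ k / u ^ j"
      using abs_poly_le_power[OF p(1), of "ln u"] by (simp add: p(2) divide_right_mono)
  qed (auto intro: sum_nonneg)
qed

subsection \<open>The constants \<open>E\<close>\<close>

text \<open>\<open>Cc\<close> and \<open>E\<close> are given by iterated \<open>deriv\<close> at 0;
  this lets them be read off as coefficients of power series. The induction passes to the
  derivative, so it varies both f and F.\<close>

lemma real_fps_nth_fps_expansion:
  fixes f :: "real \<Rightarrow> real"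
  assumes "f has_fps_expansion F"
  shows "fps_nth F n = (deriv ^^ n) f 0 / fact n"
  using assms
proof (induction n arbitrary: f F)
  case 0
  hence "f 0 = eval_fps F 0"
    by (auto simp: has_fps_expansion_def dest: eventually_nhds_x_imp_x)
  thus ?case by (simp add: eval_fps_at_0)
next
  case (Suc n)
  have "deriv f has_fps_expansion fps_deriv F"
  proof -
    have "eventually (\<lambda>z. z \<in> eball 0 (fps_conv_radius F)) (nhds 0)"
      using Suc.prems by (intro eventually_nhds_in_open) (auto simp: has_fps_expansion_def zero_ereal_def)
    \<comment> \<open>Derivatives at a nearby z agree only if the functions agree on a neighbourhood
      of that z.\<close>
    moreover have "eventually (\<lambda>z. eventually (\<lambda>w. eval_fps F w = f w) (nhds z)) (nhds 0)"
      using Suc.prems by (auto simp: has_fps_expansion_def eventually_eventually)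
    ultimately have "eventually (\<lambda>z. eval_fps (fps_deriv F) z = deriv f z) (nhds 0)"
    proof eventually_elim
      case (elim z)
      have "deriv f z = deriv (eval_fps F) z"
        by (intro deriv_cong_ev) (use elim in \<open>auto elim: eventually_mono\<close>)
      also have "\<dots> = eval_fps (fps_deriv F) z"
        by (intro DERIV_imp_deriv has_field_derivative_eval_fps) (use elim in auto)
      finally show ?case by simp
    qed
    thus ?thesis
      using Suc.prems fps_conv_radius_deriv[of F] by (auto simp: has_fps_expansion_def)
  qed
  from Suc.IH [OF this] have "real (Suc n) * fps_nth F (Suc n) = (deriv ^^ Suc n) f 0 / fact n"
    by (simp add: funpow_Suc_right del: funpow.simps)
  thus ?case
    by (simp add: field_simps del: funpow.simps of_nat_Suc)
qed

lemma real_fps_expansion_unique: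
  fixes f :: "real \<Rightarrow> real"
  assumes "f has_fps_expansion F" "f has_fps_expansion G"
  shows "F = G"
  by (rule fps_ext) (use assms in \<open>simp add: real_fps_nth_fps_expansion\<close>)

lemma has_fps_expansion_eventually_cong:
  assumes "f has_fps_expansion F" "eventually (\<lambda>x. f x = g x) (nhds 0)"
  shows "g has_fps_expansion F"
  using assms unfolding has_fps_expansion_def by (auto elim: eventually_elim2)

lemma has_fps_expansion_uminus_arg:
  fixes f :: "real \<Rightarrow> real"
  assumes "f has_fps_expansion F"
  shows "(\<lambda>x. f (- x)) has_fps_expansion Abs_fps (\<lambda>n. (-1) ^ n * fps_nth F n)"
proof (rule has_fps_expansionI)
  have "eventually (\<lambda>z. z \<in> eball 0 (fps_conv_radius F)) (nhds 0)"
    using assms by (intro eventually_nhds_in_open) (auto simp: has_fps_expansion_def zero_ereal_def)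
  moreover have "eventually (\<lambda>z. eval_fps F z = f z) (nhds 0)"
    using assms by (simp add: has_fps_expansion_def)
  ultimately have "eventually (\<lambda>z. (\<lambda>n. fps_nth F n * z ^ n) sums f z) (nhds 0)"
  proof eventually_elim
    case (elim z)
    thus ?case using sums_eval_fps[of z F] by simp
  qed
  moreover have "filterlim uminus (nhds (0 :: real)) (nhds 0)"
    using tendsto_minus [OF filterlim_ident, of "0 :: real"] by simp
  ultimately have "eventually (\<lambda>z. (\<lambda>n. fps_nth F n * (- z) ^ n) sums f (- z)) (nhds 0)"
    by (rule eventually_compose_filterlim)
  moreover have "fps_nth (Abs_fps (\<lambda>n. (-1) ^ n * fps_nth F n)) n * z ^ n = fps_nth F n * (- z) ^ n" for n z
    by (subst power_minus) simp
  ultimately show "eventually (\<lambda>z. (\<lambda>n. fps_nth (Abs_fps (\<lambda>n. (-1) ^ n * fps_nth F n)) n * z ^ n) sums f (- z)) (nhds 0)"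
    by (simp only:)
qed

text \<open>The power series of Ein: 1 - e^(-X) has constant term 0, so \<open>fps_shift 1\<close>
  is division by X.\<close>

definition fps_Ein :: "real fps" where
  "fps_Ein = fps_integral0 (fps_shift 1 (1 - fps_exp (-1)))"

lemma fps_X_times_deriv_fps_Ein: "fps_X * fps_deriv fps_Ein = 1 - fps_exp (-1)"
proof (rule fps_ext)
  fix n show "fps_nth (fps_X * fps_deriv fps_Ein) n = fps_nth (1 - fps_exp (-1)) n"
    by (cases n) (auto simp: fps_Ein_def fps_deriv_fps_integral)
qed

text \<open>Integration divides coefficients by \<open>Suc n\<close> \<ge> 1, so convergence is
  inherited from the entire series of (1 - e^(-z))/z.\<close>

lemma fps_conv_radius_Ein: "fps_conv_radius fps_Ein = \<infinity>"
proof -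
  define h where "h = fps_shift 1 (1 - fps_exp (-1) :: real fps)"
  have "fps_conv_radius (1 - fps_exp (-1) :: real fps) \<ge> \<infinity>"
    using fps_conv_radius_diff[of "1 :: real fps" "fps_exp (-1)"] by simp
  hence h: "fps_conv_radius h = \<infinity>" by (simp add: h_def)
  have "summable (\<lambda>n. fps_nth fps_Ein n * z ^ n)" for z
  proof -
    have "summable (\<lambda>n. norm (fps_nth h n * z ^ n))"
      using h by (intro abs_summable_in_conv_radius) (auto simp: fps_conv_radius_def)
    hence "summable (\<lambda>n. \<bar>z\<bar> * norm (fps_nth h n * z ^ n))"
      by (rule summable_mult)
    hence "summable (\<lambda>n. fps_nth fps_Ein (Suc n) * z ^ Suc n)"
    proof (rule summable_comparison_test')
      fix n :: nat
      have "inverse (real (Suc n)) \<le> 1" by (simp add: field_simps)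
      hence "inverse (real (Suc n)) * (\<bar>z\<bar> * norm (fps_nth h n * z ^ n)) \<le> 1 * (\<bar>z\<bar> * norm (fps_nth h n * z ^ n))"
        by (intro mult_right_mono) auto
      thus "norm (fps_nth fps_Ein (Suc n) * z ^ Suc n) \<le> \<bar>z\<bar> * norm (fps_nth h n * z ^ n)"
        by (simp add: fps_Ein_def h_def abs_mult mult_ac power_abs del: of_nat_Suc)
    qed
    thus ?thesis by (subst (asm) summable_Suc_iff)
  qed
  thus ?thesis
    unfolding fps_conv_radius_def by (intro conv_radius_inftyI'') auto
qed

lemma Ein_eq_eval_fps: "(LBINT t=0..z. (1 - exp (- t)) / t) = eval_fps fps_Ein z"
proof -
  have deriv: "(eval_fps fps_Ein has_real_derivative eval_fps (fps_deriv fps_Ein) x) (at x within A)" for x A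
    by (rule has_field_derivative_eval_fps) (simp add: fps_conv_radius_Ein)
  have rad: "fps_conv_radius (fps_deriv fps_Ein) = \<infinity>"
    using fps_conv_radius_deriv[of fps_Ein] by (simp add: fps_conv_radius_Ein)
  have eval: "eval_fps (fps_deriv fps_Ein) t = (1 - exp (- t)) / t" if "t \<noteq> 0" for t
  proof -
    have "eval_fps (fps_X * fps_deriv fps_Ein) t = t * eval_fps (fps_deriv fps_Ein) t"
      by (subst eval_fps_mult) (auto simp: rad)
    moreover have "eval_fps (fps_X * fps_deriv fps_Ein) t = 1 - exp (- t)"
      unfolding fps_X_times_deriv_fps_Ein by (subst eval_fps_diff) auto
    ultimately show ?thesis using that by (simp add: field_simps)
  qed
  \<comment> \<open>At t = 0 the quotient has the default value 0 while the series has value 1; but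
    0 is an endpoint, and the congruence is over the open interval.\<close>
  have "(LBINT t=0..z. (1 - exp (- t)) / t) = (LBINT t=ereal 0..ereal z. eval_fps (fps_deriv fps_Ein) t)"
    unfolding zero_ereal_def [symmetric]
    by (rule interval_integral_cong) (auto simp: einterval_def eval min_def max_def zero_ereal_def split: if_splits)
  also have "\<dots> = eval_fps fps_Ein z - eval_fps fps_Ein 0"
  proof (rule interval_integral_FTC_finite)
    show "continuous_on {min 0 z..max 0 z} (eval_fps (fps_deriv fps_Ein))"
      by (rule continuous_on_eval_fps [THEN continuous_on_subset]) (auto simp: rad)
  qed (use deriv in \<open>auto simp flip: has_real_derivative_iff_has_vector_derivative\<close>)
  also have "eval_fps fps_Ein 0 = 0"
    by (simp add: eval_fps_at_0 fps_Ein_def)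
  finally show ?thesis by simp
qed

lemma E_eq_fps_nth: "E j m = fps_nth (fps_Ein ^ m) j"
proof -
  have "(\<lambda>z. \<Prod>i<m. eval_fps fps_Ein z) has_fps_expansion (\<Prod>i<m. fps_Ein)"
    by (intro has_fps_expansion_prod eval_fps_has_fps_expansion) (simp add: fps_conv_radius_Ein)
  hence "(\<lambda>z. eval_fps fps_Ein z ^ m) has_fps_expansion fps_Ein ^ m"
    by simp
  from real_fps_nth_fps_expansion [OF this] show ?thesis
    by (simp add: E_def Ein_eq_eval_fps)
qed

lemma E_0: "E j 0 = (if j = 0 then 1 else 0)"
  by (simp add: E_eq_fps_nth)

text \<open>Apply z d/dz to Ein^(m+1), use z Ein'(z) = 1 - e^(-z) and compare coefficients of
  z^j.\<close>

lemma E_Suc_recurrence: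
  "real j * E j (Suc m) = real (Suc m) * (E j m - (\<Sum>i\<le>j. (-1) ^ i / fact i * E (j - i) m))"
proof -
  have "fps_X * fps_deriv (fps_Ein ^ Suc m) =
        fps_const (real (Suc m)) * (fps_Ein ^ m * (fps_X * fps_deriv fps_Ein))"
    unfolding fps_deriv_power by (simp add: mult_ac)
  also have "\<dots> = fps_const (real (Suc m)) * (fps_Ein ^ m - fps_exp (-1) * fps_Ein ^ m)"
    unfolding fps_X_times_deriv_fps_Ein by (simp add: algebra_simps)
  finally have "fps_nth (fps_X * fps_deriv (fps_Ein ^ Suc m)) j =
        fps_nth (fps_const (real (Suc m)) * (fps_Ein ^ m - fps_exp (-1) * fps_Ein ^ m)) j"
    by (rule arg_cong)
  moreover have "fps_nth (fps_X * fps_deriv (fps_Ein ^ Suc m)) j = real j * E j (Suc m)"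
    by (cases j) (simp_all add: E_eq_fps_nth del: power_Suc)
  moreover have "fps_nth (fps_exp (-1) * fps_Ein ^ m) j = (\<Sum>i\<le>j. (-1) ^ i / fact i * E (j - i) m)"
    by (simp add: fps_mult_nth E_eq_fps_nth atLeast0AtMost)
  ultimately show ?thesis
    by (simp add: E_eq_fps_nth)
qed

subsection \<open>The constants \<open>C\<^sub>r\<close> and logarithmic moments\<close>

lemma has_bochner_integral_Gamma:
  assumes "a > (0::real)"
  shows "has_bochner_integral lborel (\<lambda>v. indicator {0<..} v * (exp (- v) * v powr (a - 1))) (Gamma a)"
proof (rule has_bochner_integral_nn_integral)
  show "(\<integral>\<^sup>+ v. ennreal (indicator {0<..} v * (exp (- v) * v powr (a - 1))) \<partial>lborel) = ennreal (Gamma a)"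
    unfolding Gamma_conv_nn_integral_real [OF assms]
    by (intro nn_integral_cong) (auto simp: indicator_def exp_minus field_simps)
  show "Gamma a \<ge> 0" using Gamma_real_pos [OF assms] by simp
qed auto

lemma partial_exp_sum_le:
  fixes x :: real
  assumes "x \<ge> 0"
  shows "(\<Sum>k<n. x ^ k / fact k) \<le> exp x"
proof -
  have "(\<lambda>k. x ^ k / fact k) sums exp x"
    using exp_converges[of x] by (simp add: field_simps)
  hence summable: "summable (\<lambda>k. x ^ k / fact k)" and eq: "(\<Sum>k. x ^ k / fact k) = exp x"
    by (auto simp: sums_iff)
  have "(\<Sum>k<n. x ^ k / fact k) \<le> (\<Sum>k. x ^ k / fact k)"
    by (rule sum_le_suminf [OF summable]) (use assms in auto)
  thus ?thesis by (simp only: eq)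
qed

lemma power_le_fact_times_exp:
  fixes x :: real
  assumes "x \<ge> 0"
  shows "x ^ k / fact k \<le> exp x"
proof -
  have "x ^ k / fact k \<le> (\<Sum>i<Suc k. x ^ i / fact i)"
    by (rule member_le_sum) (use assms in auto)
  also have "\<dots> \<le> exp x" by (rule partial_exp_sum_le [OF assms])
  finally show ?thesis .
qed

text \<open>A common majorant for powers of ln v and for v^z with |z| \<le> 1/2; times e^(-v) it
  remains integrable at 0.\<close>

lemma exp_half_abs_ln_le:
  fixes v :: real
  assumes "v > 0"
  shows "exp (\<bar>ln v\<bar> / 2) \<le> v powr (1 / 2) + v powr (- 1 / 2)"
proof -
  have "exp (\<bar>ln v\<bar> / 2) \<le> exp (ln v / 2) + exp (- ln v / 2)"
    by (cases "ln v \<ge> 0") (auto simp: abs_if)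
  thus ?thesis using assms by (simp add: powr_def)
qed

text \<open>The k-th Taylor coefficient of \<Gamma>(1 + z) at 0, obtained by expanding v^z in the
  Gamma integral.\<close>

definition ln_moment :: "nat \<Rightarrow> real" where
  "ln_moment k = (LBINT v. indicator {0<..} v * (exp (- v) * (ln v ^ k / fact k)))"

lemma integrable_Gamma_majorant:
  "integrable lborel (\<lambda>v::real. indicator {0<..} v * (exp (- v) * (v powr (1 / 2) + v powr (- 1 / 2))))"
proof -
  have "integrable lborel (\<lambda>v::real. indicator {0<..} v * (exp (- v) * v powr (3 / 2 - 1)) +
     indicator {0<..} v * (exp (- v) * v powr (1 / 2 - 1)))"
    using has_bochner_integral_Gamma[of "3 / 2"] has_bochner_integral_Gamma[of "1 / 2"]
    by (intro Bochner_Integration.integrable_add) (auto simp: has_bochner_integral_iff)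
  thus ?thesis by (simp add: distrib_left)
qed

lemma has_bochner_integral_ln_moment:
  "has_bochner_integral lborel (\<lambda>v. indicator {0<..} v * (exp (- v) * (ln v ^ k / fact k))) (ln_moment k)"
proof -
  have "integrable lborel (\<lambda>v::real. indicator {0<..} v * (exp (- v) * (ln v ^ k / fact k)))"
  proof (rule Bochner_Integration.integrable_bound)
    show "integrable lborel (\<lambda>v::real. 2 ^ k * (indicator {0<..} v * (exp (- v) * (v powr (1 / 2) + v powr (- 1 / 2)))))"
      by (intro integrable_mult_right integrable_Gamma_majorant)
    have "exp (- v) * \<bar>ln v ^ k / fact k\<bar> \<le> exp (- v) * (2 ^ k * (v powr (1 / 2) + v powr (- 1 / 2)))"
      if "v > 0" for v :: real
    proof (rule mult_left_mono)
      \<comment> \<open>Halving ln v makes the exponential bound end in exponents 1/2 and -1/2, at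
        the price of 2^k.\<close>
      have "\<bar>ln v ^ k / fact k\<bar> = 2 ^ k * ((\<bar>ln v\<bar> / 2) ^ k / fact k)"
        by (simp add: power_divide power_abs)
      also have "\<dots> \<le> 2 ^ k * (v powr (1 / 2) + v powr (- 1 / 2))"
        using power_le_fact_times_exp[of "\<bar>ln v\<bar> / 2" k] exp_half_abs_ln_le [OF that]
        by (intro mult_left_mono) auto
      finally show "\<bar>ln v ^ k / fact k\<bar> \<le> 2 ^ k * (v powr (1 / 2) + v powr (- 1 / 2))" .
    qed simp
    thus "AE v :: real in lborel. norm (indicator {0<..} v * (exp (- v) * (ln v ^ k / fact k))) \<le>
        norm (2 ^ k * (indicator {0<..} v * (exp (- v) * (v powr (1 / 2) + v powr (- 1 / 2)))))"
      by (intro AE_I2) (auto simp: indicator_def abs_mult mult.left_commute [of "2 ^ k"])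
  qed auto
  thus ?thesis by (simp add: has_bochner_integral_iff ln_moment_def)
qed

text \<open>The series of v^z in powers of z ln v is integrated termwise by dominated convergence:
  its partial sums are at most e^(|ln v|/2).\<close>

lemma ln_moment_sums_Gamma:
  assumes "\<bar>z\<bar> \<le> 1 / 2"
  shows "(\<lambda>k. ln_moment k * z ^ k) sums Gamma (1 + z)"
proof -
  define f where "f = (\<lambda>n v. \<Sum>k<n. z ^ k * (indicator {0<..} v * (exp (- v) * (ln v ^ k / fact k))))"
  define g where "g = (\<lambda>v. indicator {0<..} v * (exp (- v) * v powr (1 + z - 1)))"
  have "(\<lambda>n. integral\<^sup>L lborel (f n)) \<longlonglongrightarrow> integral\<^sup>L lborel g"
  proof (rule integral_dominated_convergence)
    show "integrable lborel (\<lambda>v::real. indicator {0<..} v * (exp (- v) * (v powr (1 / 2) + v powr (- 1 / 2))))"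
      by (rule integrable_Gamma_majorant)
    show "AE v in lborel. (\<lambda>n. f n v) \<longlonglongrightarrow> g v"
    proof (intro AE_I2)
      fix v :: real
      show "(\<lambda>n. f n v) \<longlonglongrightarrow> g v"
      proof (cases "v > 0")
        case True
        have "(\<lambda>k. exp (- v) * ((z * ln v) ^ k / fact k)) sums (exp (- v) * exp (z * ln v))"
          using exp_converges[of "z * ln v"] by (intro sums_mult) (simp add: field_simps)
        thus ?thesis using True
          by (simp add: sums_def f_def g_def powr_def power_mult_distrib mult_ac)
      qed (simp add: f_def g_def)
    qed
    show "AE v in lborel. norm (f n v) \<le> indicator {0<..} v * (exp (- v) * (v powr (1 / 2) + v powr (- 1 / 2)))" for n
    proof (intro AE_I2)
      fix v :: real
      show "norm (f n v) \<le> indicator {0<..} v * (exp (- v) * (v powr (1 / 2) + v powr (- 1 / 2)))"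
      proof (cases "v > 0")
        case True
        have "f n v = exp (- v) * (\<Sum>k<n. (z * ln v) ^ k / fact k)"
          using True by (simp add: f_def power_mult_distrib sum_distrib_left mult_ac)
        hence "norm (f n v) = exp (- v) * \<bar>\<Sum>k<n. (z * ln v) ^ k / fact k\<bar>"
          by (simp add: abs_mult)
        also have "\<bar>\<Sum>k<n. (z * ln v) ^ k / fact k\<bar> \<le> (\<Sum>k<n. \<bar>z * ln v\<bar> ^ k / fact k)"
          by (rule order_trans [OF sum_abs]) (simp add: power_abs)
        also have "\<dots> \<le> exp \<bar>z * ln v\<bar>"
          by (rule partial_exp_sum_le) simp
        also have "\<dots> \<le> exp (\<bar>ln v\<bar> / 2)"
          using mult_right_mono [OF assms, of "\<bar>ln v\<bar>"] by (simp add: abs_mult)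
        also note exp_half_abs_ln_le [OF True]
        finally show ?thesis using True by (simp add: mult_left_mono)
      qed (simp add: f_def)
    qed
  qed (auto simp: f_def g_def)
  moreover have "integral\<^sup>L lborel (f n) = (\<Sum>k<n. ln_moment k * z ^ k)" for n
  proof -
    have "has_bochner_integral lborel (f n) (\<Sum>k<n. z ^ k * ln_moment k)"
      unfolding f_def by (intro has_bochner_integral_sum has_bochner_integral_mult_right has_bochner_integral_ln_moment)
    thus ?thesis by (simp add: has_bochner_integral_iff mult_ac)
  qed
  moreover have "integral\<^sup>L lborel g = Gamma (1 + z)"
    using has_bochner_integral_Gamma[of "1 + z"] assms unfolding g_def by (simp add: has_bochner_integral_iff)
  ultimately show ?thesis by (simp add: sums_def)
qed

lemma Gamma_has_fps_expansion: "(\<lambda>z. Gamma (1 + z)) has_fps_expansion Abs_fps ln_moment"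
proof (rule has_fps_expansionI)
  have "eventually (\<lambda>z::real. z \<in> {-1/2<..<1/2}) (nhds 0)"
    by (intro eventually_nhds_in_open) auto
  thus "eventually (\<lambda>z. (\<lambda>n. fps_nth (Abs_fps ln_moment) n * z ^ n) sums Gamma (1 + z)) (nhds 0)"
    by eventually_elim (auto intro!: ln_moment_sums_Gamma)
qed

lemma ln_moment_0: "ln_moment 0 = 1"
  using real_fps_nth_fps_expansion [OF Gamma_has_fps_expansion, of 0] by simp

lemma ln_moment_1: "ln_moment (Suc 0) = - euler_mascheroni"
proof -
  have "((\<lambda>z::real. Gamma (1 + z)) has_field_derivative - euler_mascheroni) (at 0)"
    by (auto intro!: derivative_eq_intros)
  hence "deriv (\<lambda>z::real. Gamma (1 + z)) 0 = - euler_mascheroni"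
    by (rule DERIV_imp_deriv)
  thus ?thesis
    using real_fps_nth_fps_expansion [OF Gamma_has_fps_expansion, of 1] by simp
qed

text \<open>The generating function of the C_r at -z, that is e^(-\<gamma> z)/\<Gamma>(1 + z); it
  absorbs the signs (-1)^r of the expansion.\<close>

definition fps_alt_Cc :: "real fps" where
  "fps_alt_Cc = Abs_fps (\<lambda>r. (-1) ^ r * Cc r)"

lemma fps_alt_Cc_expansion:
  "(\<lambda>z. exp (- euler_mascheroni * z) * rGamma (1 + z)) has_fps_expansion fps_alt_Cc"
proof -
  define G where "G = Abs_fps (\<lambda>n. (-1) ^ n * ln_moment n)"
  have "(\<lambda>z. Gamma (1 + - z)) has_fps_expansion G"
    using has_fps_expansion_uminus_arg [OF Gamma_has_fps_expansion] by (simp add: G_def)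
  hence "(\<lambda>z. inverse (Gamma (1 + - z))) has_fps_expansion inverse G"
    by (rule has_fps_expansion_inverse) (simp add: G_def ln_moment_0)
  hence "(\<lambda>z. exp (euler_mascheroni * z) * inverse (Gamma (1 + - z))) has_fps_expansion
     fps_exp euler_mascheroni * inverse G"
    by (intro has_fps_expansion_mult has_fps_expansion_exp)
  hence *: "(\<lambda>z. exp (euler_mascheroni * z) * rGamma (1 - z)) has_fps_expansion
     fps_exp euler_mascheroni * inverse G"
    by (simp add: rGamma_inverse_Gamma)
  have "fps_nth (fps_exp euler_mascheroni * inverse G) r = Cc r" for r
    using real_fps_nth_fps_expansion [OF *, of r] by (simp add: Cc_def)
  with has_fps_expansion_uminus_arg [OF *] show ?thesis
    by (simp add: fps_alt_Cc_def)
qed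

text \<open>The relation that singles out the C_r: integrating powers of ln v against e^(-v)
  multiplies by the moment series, and only a pure exponential remains.\<close>

lemma fps_alt_Cc_times_Gamma: "fps_alt_Cc * Abs_fps ln_moment = fps_exp (- euler_mascheroni)"
proof (rule real_fps_expansion_unique)
  have "(\<lambda>z::real. exp (- euler_mascheroni * z) * rGamma (1 + z) * Gamma (1 + z)) has_fps_expansion
     fps_alt_Cc * Abs_fps ln_moment"
    by (intro has_fps_expansion_mult fps_alt_Cc_expansion Gamma_has_fps_expansion)
  thus "(\<lambda>z. exp (- euler_mascheroni * z)) has_fps_expansion fps_alt_Cc * Abs_fps ln_moment"
  proof (rule has_fps_expansion_eventually_cong)
    have "eventually (\<lambda>z::real. z \<in> {-1<..<1}) (nhds 0)"
      by (intro eventually_nhds_in_open) auto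
    thus "eventually (\<lambda>z::real. exp (- euler_mascheroni * z) * rGamma (1 + z) * Gamma (1 + z) =
       exp (- euler_mascheroni * z)) (nhds 0)"
    proof eventually_elim
      case (elim z)
      hence "Gamma (1 + z) > 0" by (intro Gamma_real_pos) auto
      thus ?case by (simp add: rGamma_inverse_Gamma)
    qed
  qed
qed (rule has_fps_expansion_exp)

lemma Cc_0: "Cc 0 = 1"
  using arg_cong [OF fps_alt_Cc_times_Gamma, of "\<lambda>F. fps_nth F 0"]
  by (simp add: fps_alt_Cc_def ln_moment_0)

text \<open>\<Gamma>'(1) = -\<gamma> balances the first-order term of e^(-\<gamma> z). Hence
  \<open>log_poly 1\<close> is the identity, in exact agreement with \<open>K 1\<close> for u \<ge>
  1.\<close>

lemma Cc_1: "Cc (Suc 0) = 0"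
  using arg_cong [OF fps_alt_Cc_times_Gamma, of "\<lambda>F. fps_nth F 1"]
  by (simp add: fps_alt_Cc_def fps_mult_nth ln_moment_0 ln_moment_1 Cc_0)

text \<open>The Q_k of the opening sketch at x = ln u, with generating function u^z e^(-\<gamma>
  z)/\<Gamma>(1 + z).\<close>

definition log_poly :: "nat \<Rightarrow> real \<Rightarrow> real" where
  "log_poly k x = fps_nth (fps_alt_Cc * fps_exp x) k"

lemma log_poly_altdef: "log_poly k x = (\<Sum>r\<le>k. (-1) ^ r * Cc r / fact (k - r) * x ^ (k - r))"
  by (simp add: log_poly_def fps_mult_nth fps_alt_Cc_def atLeast0AtMost)

section \<open>Laplace transforms of polynomials in ln u\<close>

lemma Laplace_transform_rescale:
  fixes f :: "real \<Rightarrow> real"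
  assumes "s > 0" "has_bochner_integral lborel (\<lambda>v. indicator {0<..} v * (exp (- v) * f (v / s))) I"
  shows "has_bochner_integral lborel (\<lambda>u. indicator {0<..} u * (s * exp (- s * u) * f u)) I"
proof -
  have "has_bochner_integral lborel (\<lambda>u. indicator {0<..} (0 + s * u) * (exp (- (0 + s * u)) * f ((0 + s * u) / s))) (I /\<^sub>R \<bar>s\<bar>)"
    using assms by (subst (asm) lborel_has_bochner_integral_real_affine_iff [of s _ _ 0]) auto
  hence "has_bochner_integral lborel (\<lambda>u. s * (indicator {0<..} (0 + s * u) * (exp (- (0 + s * u)) * f ((0 + s * u) / s)))) (s * (I /\<^sub>R \<bar>s\<bar>))"
    by (rule has_bochner_integral_mult_right)
  also have "s * (I /\<^sub>R \<bar>s\<bar>) = I" using assms(1) by (simp add: field_simps)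
  also have "(\<lambda>u. s * (indicator {0<..} (0 + s * u) * (exp (- (0 + s * u)) * f ((0 + s * u) / s)))) =
     (\<lambda>u. indicator {0<..} u * (s * exp (- s * u) * f u))"
    using assms(1) by (auto simp: fun_eq_iff indicator_def zero_less_mult_iff)
  finally show ?thesis .
qed

text \<open>After the scaling v = s u the generating function splits into v^z and a factor free of
  v. Integrating v^z against e^(-v) gives \<Gamma>(1 + z), which cancels the one in
  \<open>log_poly\<close> and leaves e^((-\<gamma> - ln s) z).\<close>

lemma Laplace_transform_log_poly:
  assumes "s > 0"
  shows "has_bochner_integral lborel (\<lambda>u. indicator {0<..} u * (s * exp (- s * u) * log_poly k (ln u)))
           ((- euler_mascheroni - ln s) ^ k / fact k)"
proof (rule Laplace_transform_rescale [OF assms])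
  define B where "B = fps_alt_Cc * fps_exp (- ln s)"
  have "has_bochner_integral lborel
     (\<lambda>v. \<Sum>i\<le>k. fps_nth B (k - i) * (indicator {0<..} v * (exp (- v) * (ln v ^ i / fact i))))
     (\<Sum>i\<le>k. fps_nth B (k - i) * ln_moment i)"
    by (intro has_bochner_integral_sum has_bochner_integral_mult_right has_bochner_integral_ln_moment)
  also have "(\<lambda>v. \<Sum>i\<le>k. fps_nth B (k - i) * (indicator {0<..} v * (exp (- v) * (ln v ^ i / fact i)))) =
     (\<lambda>v. indicator {0<..} v * (exp (- v) * log_poly k (ln (v / s))))"
  proof
    fix v :: real
    show "(\<Sum>i\<le>k. fps_nth B (k - i) * (indicator {0<..} v * (exp (- v) * (ln v ^ i / fact i)))) =
       indicator {0<..} v * (exp (- v) * log_poly k (ln (v / s)))"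
    proof (cases "v > 0")
      case True
      have "fps_alt_Cc * fps_exp (ln (v / s)) = fps_exp (ln v) * B"
        using True assms by (simp add: B_def ln_div mult_ac flip: fps_exp_add_mult)
      hence "log_poly k (ln (v / s)) = (\<Sum>i\<le>k. ln v ^ i / fact i * fps_nth B (k - i))"
        by (simp add: log_poly_def fps_mult_nth atLeast0AtMost)
      thus ?thesis using True
        by (simp add: sum_distrib_left mult_ac)
    qed simp
  qed
  also have "(\<Sum>i\<le>k. fps_nth B (k - i) * ln_moment i) = fps_nth (Abs_fps ln_moment * B) k"
    unfolding fps_mult_nth atLeast0AtMost by (simp add: mult.commute)
  also have "Abs_fps ln_moment * B = fps_exp (- euler_mascheroni - ln s)"
    using fps_alt_Cc_times_Gamma by (simp add: B_def fps_exp_add_mult [of "- euler_mascheroni" "- ln s", simplified] mult_ac)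
  finally show "has_bochner_integral lborel (\<lambda>v. indicator {0<..} v * (exp (- v) * log_poly k (ln (v / s))))
     ((- euler_mascheroni - ln s) ^ k / fact k)"
    by simp
qed

text \<open>The comparison function u^(-1/2) has transform \<Gamma>(1/2) sqrt s = sqrt pi * sqrt s.
  It is integrable at 0 and decays at infinity, so one bound serves the whole half-line.\<close>

lemma Laplace_transform_bound:
  fixes f :: "real \<Rightarrow> real"
  assumes "s > 0" "has_bochner_integral lborel (\<lambda>u. indicator {0<..} u * (s * exp (- s * u) * f u)) I"
    and bound: "\<And>u. u > 0 \<Longrightarrow> \<bar>f u\<bar> \<le> B * u powr (- 1 / 2)"
  shows "\<bar>I\<bar> \<le> B * sqrt pi * sqrt s"
proof -
  have "has_bochner_integral lborel (\<lambda>v. B * sqrt s * (indicator {0<..} v * (exp (- v) * v powr (1 / 2 - 1))))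
     (B * sqrt s * Gamma (1 / 2))"
    by (intro has_bochner_integral_mult_right has_bochner_integral_Gamma) simp
  also have "(\<lambda>v. B * sqrt s * (indicator {0<..} v * (exp (- v) * v powr (1 / 2 - 1)))) =
     (\<lambda>v. indicator {0<..} v * (exp (- v) * (B * (v / s) powr (- 1 / 2))))"
    using assms(1) by (auto simp: fun_eq_iff indicator_def powr_divide powr_minus powr_half_sqrt field_simps)
  finally have *: "has_bochner_integral lborel (\<lambda>u. indicator {0<..} u * (s * exp (- s * u) * (B * u powr (- 1 / 2))))
     (B * sqrt s * Gamma (1 / 2))"
    by (rule Laplace_transform_rescale [OF assms(1)])
  have "norm I \<le> B * sqrt s * Gamma (1 / 2)"
    unfolding has_bochner_integral_integral_eq [OF assms(2), symmetric] has_bochner_integral_integral_eq [OF *, symmetric]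
  proof (rule Bochner_Integration.integral_norm_bound_integral)
    fix u :: real
    show "norm (indicator {0<..} u * (s * exp (- s * u) * f u)) \<le>
       indicator {0<..} u * (s * exp (- s * u) * (B * u powr (- 1 / 2)))"
      using bound[of u] assms(1) by (auto simp: indicator_def abs_mult)
  qed (use assms(2) * in \<open>auto simp: has_bochner_integral_iff\<close>)
  thus ?thesis by (simp add: Gamma_one_half_real mult_ac)
qed

subsection \<open>The asymptotic expansion\<close>

definition log_poly_deriv :: "nat \<Rightarrow> nat \<Rightarrow> real \<Rightarrow> real" where
  "log_poly_deriv j k u =
     (\<Sum>r\<le>k. (-1) ^ r * Cc r / fact (k - r) * (deriv ^^ j) (\<lambda>x. ln x ^ (k - r)) u)"

lemma log_poly_deriv_0: "log_poly_deriv 0 k u = log_poly k (ln u)"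
  by (simp add: log_poly_deriv_def log_poly_altdef)

lemma has_real_derivative_log_poly_deriv:
  assumes "u > 0"
  shows "(log_poly_deriv j k has_real_derivative log_poly_deriv (Suc j) k u) (at u)"
  unfolding log_poly_deriv_def
  by (intro DERIV_sum DERIV_cmult has_real_derivative_higher_deriv_ln_power assms)

text \<open>The identity u D Q_k = Q_(k-1) differentiated j times, with Q_(-1) = 0.\<close>

lemma log_poly_deriv_recurrence:
  assumes "u > 0"
  shows "u * log_poly_deriv (Suc j) k u =
    (if k = 0 then 0 else log_poly_deriv j (k - 1) u) - real j * log_poly_deriv j k u"
proof -
  let ?L = "\<lambda>j k. (deriv ^^ j) (\<lambda>x::real. ln x ^ k) u"
  let ?c = "\<lambda>r. (-1) ^ r * Cc r"
  have "u * log_poly_deriv (Suc j) k u = (\<Sum>r\<le>k. ?c r / fact (k - r) * (u * ?L (Suc j) (k - r)))"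
    by (simp add: log_poly_deriv_def sum_distrib_left mult_ac del: funpow.simps)
  also have "\<dots> = (\<Sum>r\<le>k. ?c r / fact (k - r) * (real (k - r) * ?L j (k - r - 1)) -
      real j * (?c r / fact (k - r) * ?L j (k - r)))"
    unfolding higher_deriv_ln_power_recurrence [OF assms] by (simp add: algebra_simps)
  also have "\<dots> = (\<Sum>r\<le>k. ?c r / fact (k - r) * (real (k - r) * ?L j (k - r - 1))) -
      real j * log_poly_deriv j k u"
    by (simp add: sum_subtractf log_poly_deriv_def sum_distrib_left)
  also have "(\<Sum>r\<le>k. ?c r / fact (k - r) * (real (k - r) * ?L j (k - r - 1))) =
     (if k = 0 then 0 else log_poly_deriv j (k - 1) u)"
  proof (cases k)
    case (Suc k')
    \<comment> \<open>The factor \<open>Suc k' - r\<close> lowers the factorial; in the summand r =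
      \<open>Suc k'\<close> it is 0.\<close>
    have "?c r / fact (Suc k' - r) * (real (Suc k' - r) * ?L j (Suc k' - r - 1)) =
       ?c r / fact (k' - r) * ?L j (k' - r)" if "r \<le> k'" for r
      using that by (simp add: Suc_diff_le field_simps del: of_nat_Suc)
    thus ?thesis
      by (simp add: Suc log_poly_deriv_def)
  qed simp
  finally show ?thesis .
qed

lemma log_poly_deriv_bound:
  obtains C where "C \<ge> 0" "\<And>u. u \<ge> 1 \<Longrightarrow> \<bar>log_poly_deriv j k u\<bar> \<le> C * (1 + ln u) ^ k / u ^ j"
proof -
  let ?L = "\<lambda>k. (deriv ^^ j) (\<lambda>x::real. ln x ^ k)"
  have "\<forall>k. \<exists>C\<ge>0. \<forall>u\<ge>1. \<bar>?L k u\<bar> \<le> C * (1 + ln u) ^ k / u ^ j"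
    using higher_deriv_ln_power_bound by metis
  then obtain C where C: "\<And>k. C k \<ge> 0" "\<And>k u. u \<ge> 1 \<Longrightarrow> \<bar>?L k u\<bar> \<le> C k * (1 + ln u) ^ k / u ^ j"
    by metis
  show ?thesis
  proof (rule that[of "\<Sum>r\<le>k. \<bar>(-1) ^ r * Cc r / fact (k - r)\<bar> * C (k - r)"])
    fix u :: real assume u: "u \<ge> 1"
    have "\<bar>log_poly_deriv j k u\<bar> \<le> (\<Sum>r\<le>k. \<bar>(-1) ^ r * Cc r / fact (k - r) * ?L (k - r) u\<bar>)"
      unfolding log_poly_deriv_def by (rule sum_abs)
    also have "\<dots> \<le> (\<Sum>r\<le>k. \<bar>(-1) ^ r * Cc r / fact (k - r)\<bar> * (C (k - r) * (1 + ln u) ^ k / u ^ j))"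
    proof (rule sum_mono)
      fix r assume r: "r \<in> {..k}"
      have "\<bar>?L (k - r) u\<bar> \<le> C (k - r) * (1 + ln u) ^ (k - r) / u ^ j"
        by (rule C(2) [OF u])
      also have "\<dots> \<le> C (k - r) * (1 + ln u) ^ k / u ^ j"
        using u by (intro divide_right_mono mult_left_mono power_increasing C(1)) auto
      finally show "\<bar>(-1) ^ r * Cc r / fact (k - r) * ?L (k - r) u\<bar> \<le>
          \<bar>(-1) ^ r * Cc r / fact (k - r)\<bar> * (C (k - r) * (1 + ln u) ^ k / u ^ j)"
        unfolding abs_mult [of "_ / _"] by (intro mult_left_mono) auto
    qed
    finally show "\<bar>log_poly_deriv j k u\<bar> \<le>
        (\<Sum>r\<le>k. \<bar>(-1) ^ r * Cc r / fact (k - r)\<bar> * C (k - r)) * (1 + ln u) ^ k / u ^ j"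
      by (simp only: sum_distrib_right sum_divide_distrib mult.assoc times_divide_eq_right)
  qed (auto intro!: sum_nonneg mult_nonneg_nonneg divide_nonneg_nonneg C(1))
qed

text \<open>Taylor's formula at u with step -1, that is e^(-D) cut off after D^N. The intermediate
  point of the remainder exceeds u - 1 \<ge> u/2, which accounts for the factor
  \<open>2 ^ (j + Suc N)\<close>.\<close>

lemma log_poly_deriv_Taylor:
  obtains C where "C \<ge> 0"
    "\<And>u. u \<ge> 2 \<Longrightarrow> \<bar>log_poly_deriv j k (u - 1) - (\<Sum>i\<le>N. (-1) ^ i / fact i * log_poly_deriv (j + i) k u)\<bar>
       \<le> C * (1 + ln u) ^ k / u ^ (j + N + 1)"
proof -
  obtain C where C: "C \<ge> 0"
    "\<And>u. u \<ge> 1 \<Longrightarrow> \<bar>log_poly_deriv (j + Suc N) k u\<bar> \<le> C * (1 + ln u) ^ k / u ^ (j + Suc N)"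
    using log_poly_deriv_bound by blast
  show ?thesis
  proof (rule that[of "C * 2 ^ (j + Suc N)"])
    fix u :: real assume u: "u \<ge> 2"
    have "\<exists>t. u - 1 < t \<and> t < u \<and> log_poly_deriv j k (u - 1) =
       (\<Sum>m<Suc N. (log_poly_deriv (j + m) k u / fact m) * (u - 1 - u) ^ m) +
       (log_poly_deriv (j + Suc N) k t / fact (Suc N)) * (u - 1 - u) ^ Suc N"
      by (rule Taylor_down [where b = u and diff = "\<lambda>m. log_poly_deriv (j + m) k"])
         (use u in \<open>auto intro!: has_real_derivative_log_poly_deriv simp del: fact_Suc\<close>)
    then obtain t where t: "u - 1 < t" "t < u" and eq: "log_poly_deriv j k (u - 1) =
       (\<Sum>m<Suc N. (log_poly_deriv (j + m) k u / fact m) * (u - 1 - u) ^ m) +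
       (log_poly_deriv (j + Suc N) k t / fact (Suc N)) * (u - 1 - u) ^ Suc N"
      by blast
    have "(\<Sum>m<Suc N. (log_poly_deriv (j + m) k u / fact m) * (u - 1 - u) ^ m) =
       (\<Sum>i\<le>N. (-1) ^ i / fact i * log_poly_deriv (j + i) k u)"
      by (rule sum.cong) auto
    with eq have "\<bar>log_poly_deriv j k (u - 1) - (\<Sum>i\<le>N. (-1) ^ i / fact i * log_poly_deriv (j + i) k u)\<bar> =
       \<bar>log_poly_deriv (j + Suc N) k t\<bar> / fact (Suc N)"
      by (simp add: abs_mult power_abs del: fact_Suc)
    also have "\<dots> \<le> \<bar>log_poly_deriv (j + Suc N) k t\<bar> / 1"
      by (intro divide_left_mono fact_ge_1) auto
    also have "\<dots> \<le> C * (1 + ln t) ^ k / t ^ (j + Suc N)"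
      using C(2)[of t] t u by simp
    also have "\<dots> \<le> C * (1 + ln u) ^ k / (u / 2) ^ (j + Suc N)"
      using t u by (intro frac_le mult_left_mono power_mono mult_nonneg_nonneg C(1)) auto
    also have "\<dots> = C * 2 ^ (j + Suc N) * (1 + ln u) ^ k / u ^ (j + N + 1)"
      by (simp add: power_divide)
    finally show "\<bar>log_poly_deriv j k (u - 1) - (\<Sum>i\<le>N. (-1) ^ i / fact i * log_poly_deriv (j + i) k u)\<bar>
       \<le> C * 2 ^ (j + Suc N) * (1 + ln u) ^ k / u ^ (j + N + 1)" .
  qed (use C in auto)
qed

section \<open>The truncated expansion and its approximate delay equation\<close>

definition expansion :: "nat \<Rightarrow> nat \<Rightarrow> real \<Rightarrow> real" where
  "expansion J l u = (\<Sum>j\<le>J. \<Sum>m\<le>l. E j m / fact m * log_poly_deriv j (l - m) u)"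

definition expansion_deriv :: "nat \<Rightarrow> nat \<Rightarrow> real \<Rightarrow> real" where
  "expansion_deriv J l u = (\<Sum>j\<le>J. \<Sum>m\<le>l. E j m / fact m * log_poly_deriv (Suc j) (l - m) u)"

lemma has_real_derivative_expansion:
  assumes "u > 0"
  shows "(expansion J l has_real_derivative expansion_deriv J l u) (at u)"
  unfolding expansion_def expansion_deriv_def
  by (intro DERIV_sum DERIV_cmult has_real_derivative_log_poly_deriv assms)

lemma E_over_fact_recurrence:
  "real j * (E j (Suc m) / fact (Suc m)) =
    E j m / fact m - (\<Sum>i\<le>j. (-1) ^ i / fact i * (E (j - i) m / fact m))"
proof -
  have "real j * (E j (Suc m) / fact (Suc m)) =
      real (Suc m) * (E j m - (\<Sum>i\<le>j. (-1) ^ i / fact i * E (j - i) m)) / (real (Suc m) * fact m)"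
    using E_Suc_recurrence[of j m] by simp
  also have "\<dots> = (E j m - (\<Sum>i\<le>j. (-1) ^ i / fact i * E (j - i) m)) / fact m"
    by (rule mult_divide_mult_cancel_left) simp
  finally show ?thesis
    by (simp add: diff_divide_distrib sum_divide_distrib)
qed

text \<open>Commuting \<open>u\<close> past \<open>Ein(D)\<^sup>m\<close> produces \<open>D Ein'(D) = 1 - exp(-D)\<close>, and \<open>exp(-D)\<close> is the shift
  by \<open>-1\<close>; the inner sum below is its Taylor polynomial.\<close>

lemma expansion_deriv_eq_shift:
  assumes "u > 0"
  shows "u * expansion_deriv J (Suc n) u =
    (\<Sum>j\<le>J. \<Sum>m\<le>n. E j m / fact m * (\<Sum>i\<le>J - j. (-1) ^ i / fact i * log_poly_deriv (j + i) (n - m) u))"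
proof -
  define e where "e = (\<lambda>j m. E j m / fact m)"
  have e: "real j * e j (Suc m) = e j m - (\<Sum>i\<le>j. (-1) ^ i / fact i * e (j - i) m)" for j m
    unfolding e_def by (rule E_over_fact_recurrence)
  \<comment> \<open>\<open>E j 0\<close> vanishes unless j = 0. So the m = 0 term of the sum with
    factor j drops out and that sum can be shifted in m.\<close>
  have e0: "real j * e j 0 = 0" for j
    by (simp add: e_def E_0)
  let ?Q = "\<lambda>j k. log_poly_deriv j k u"
  have inner: "(\<Sum>m\<le>Suc n. e j m * (u * ?Q (Suc j) (Suc n - m))) =
     (\<Sum>m\<le>n. \<Sum>i\<le>j. (-1) ^ i / fact i * e (j - i) m * ?Q j (n - m))" for j
  proof -
    have "(\<Sum>m\<le>Suc n. e j m * (u * ?Q (Suc j) (Suc n - m))) =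
       (\<Sum>m\<le>Suc n. e j m * (if Suc n - m = 0 then 0 else ?Q j (Suc n - m - 1))) -
       (\<Sum>m\<le>Suc n. real j * e j m * ?Q j (Suc n - m))"
      unfolding log_poly_deriv_recurrence [OF assms]
      by (simp only: right_diff_distrib sum_subtractf mult_ac)
    also have "(\<Sum>m\<le>Suc n. e j m * (if Suc n - m = 0 then 0 else ?Q j (Suc n - m - 1))) =
       (\<Sum>m\<le>n. e j m * ?Q j (n - m))"
      by (auto simp: Suc_diff_le intro!: sum.cong)
    also have "(\<Sum>m\<le>Suc n. real j * e j m * ?Q j (Suc n - m)) =
       (\<Sum>m\<le>n. real j * e j (Suc m) * ?Q j (n - m))"
      unfolding sum.atMost_Suc_shift e0 by simp
    also have "(\<Sum>m\<le>n. e j m * ?Q j (n - m)) - \<dots> =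
       (\<Sum>m\<le>n. (\<Sum>i\<le>j. (-1) ^ i / fact i * e (j - i) m) * ?Q j (n - m))"
      unfolding e by (simp add: sum_subtractf left_diff_distrib)
    finally show ?thesis
      by (simp add: sum_distrib_right)
  qed
  have "u * expansion_deriv J (Suc n) u = (\<Sum>j\<le>J. \<Sum>m\<le>Suc n. e j m * (u * ?Q (Suc j) (Suc n - m)))"
    unfolding expansion_deriv_def e_def sum_distrib_left by (simp only: mult_ac)
  also have "\<dots> = (\<Sum>j\<le>J. \<Sum>m\<le>n. \<Sum>i\<le>j. (-1) ^ i / fact i * e (j - i) m * ?Q j (n - m))"
    by (simp only: inner)
  \<comment> \<open>Writing j as i + (j - i) makes the summand a function of the pair (i, j - i),
    ready for reindexing the triangle.\<close>
  also have "\<dots> = (\<Sum>m\<le>n. \<Sum>j\<le>J. \<Sum>i\<le>j. (-1) ^ i / fact i * e (j - i) m * ?Q (i + (j - i)) (n - m))"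
    by (subst sum.swap) (auto intro!: sum.cong)
  also have "\<dots> = (\<Sum>m\<le>n. \<Sum>(i, j)\<in>{(i, j). i + j \<le> J}. (-1) ^ i / fact i * e j m * ?Q (i + j) (n - m))"
    by (subst sum.triangle_reindex_eq) simp
  also have "\<dots> = (\<Sum>m\<le>n. \<Sum>(j, i)\<in>Sigma {..J} (\<lambda>j. {..J - j}). (-1) ^ i / fact i * e j m * ?Q (i + j) (n - m))"
    by (intro sum.cong refl sum.reindex_bij_witness [where i = prod.swap and j = prod.swap]) auto
  also have "\<dots> = (\<Sum>m\<le>n. \<Sum>j\<le>J. \<Sum>i\<le>J - j. (-1) ^ i / fact i * e j m * ?Q (i + j) (n - m))"
    by (simp add: sum.Sigma)
  also have "\<dots> = (\<Sum>j\<le>J. \<Sum>m\<le>n. e j m * (\<Sum>i\<le>J - j. (-1) ^ i / fact i * ?Q (j + i) (n - m)))"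
    by (subst sum.swap) (simp add: sum_distrib_left mult_ac add_ac)
  finally show ?thesis
    by (simp add: e_def)
qed

text \<open>By the previous lemma the difference is a combination of Taylor remainders. The j-th
  derivative is expanded by J - j further orders, so every remainder has the common order u^(-J-1)
  up to logarithms.\<close>

lemma expansion_delay_equation:
  obtains C where "C \<ge> 0"
    "\<And>u. u \<ge> 2 \<Longrightarrow> \<bar>expansion J n (u - 1) - u * expansion_deriv J (Suc n) u\<bar> \<le> C * (1 + ln u) ^ n / u ^ (J + 1)"
proof -
  let ?T = "\<lambda>j k u. log_poly_deriv j k (u - 1) - (\<Sum>i\<le>J - j. (-1) ^ i / fact i * log_poly_deriv (j + i) k u)"
  have "\<forall>j k. \<exists>C\<ge>0. \<forall>u\<ge>2. \<bar>?T j k u\<bar> \<le> C * (1 + ln u) ^ k / u ^ (j + (J - j) + 1)"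
  proof (intro allI)
    fix j k
    show "\<exists>C\<ge>0. \<forall>u\<ge>2. \<bar>?T j k u\<bar> \<le> C * (1 + ln u) ^ k / u ^ (j + (J - j) + 1)"
      by (rule log_poly_deriv_Taylor[of j k "J - j"]) blast
  qed
  then obtain C where C: "\<And>j k. C j k \<ge> 0"
    "\<And>j k u. u \<ge> 2 \<Longrightarrow> \<bar>?T j k u\<bar> \<le> C j k * (1 + ln u) ^ k / u ^ (j + (J - j) + 1)"
    unfolding choice_iff by blast
  show ?thesis
  proof (rule that[of "\<Sum>j\<le>J. \<Sum>m\<le>n. \<bar>E j m / fact m\<bar> * C j (n - m)"])
    fix u :: real assume u: "u \<ge> 2"
    have "expansion J n (u - 1) - u * expansion_deriv J (Suc n) u =
       (\<Sum>j\<le>J. \<Sum>m\<le>n. E j m / fact m * ?T j (n - m) u)"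
      using u by (subst expansion_deriv_eq_shift)
        (simp_all add: expansion_def right_diff_distrib sum_subtractf)
    hence "\<bar>expansion J n (u - 1) - u * expansion_deriv J (Suc n) u\<bar> =
       \<bar>\<Sum>j\<le>J. \<Sum>m\<le>n. E j m / fact m * ?T j (n - m) u\<bar>"
      by (rule arg_cong)
    also have "\<dots> \<le> (\<Sum>j\<le>J. \<bar>\<Sum>m\<le>n. E j m / fact m * ?T j (n - m) u\<bar>)"
      by (rule sum_abs)
    also have "\<dots> \<le> (\<Sum>j\<le>J. \<Sum>m\<le>n. \<bar>E j m / fact m * ?T j (n - m) u\<bar>)"
      by (intro sum_mono sum_abs)
    also have "\<dots> \<le> (\<Sum>j\<le>J. \<Sum>m\<le>n. \<bar>E j m / fact m\<bar> * (C j (n - m) * (1 + ln u) ^ n / u ^ (J + 1)))"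
    proof (intro sum_mono)
      fix j m assume j: "j \<in> {..J}" and m: "m \<in> {..n}"
      have "\<bar>?T j (n - m) u\<bar> \<le> C j (n - m) * (1 + ln u) ^ (n - m) / u ^ (j + (J - j) + 1)"
        by (rule C(2) [OF u])
      also have "\<dots> = C j (n - m) * (1 + ln u) ^ (n - m) / u ^ (J + 1)"
        using j by simp
      also have "C j (n - m) * (1 + ln u) ^ (n - m) / u ^ (J + 1) \<le> C j (n - m) * (1 + ln u) ^ n / u ^ (J + 1)"
        using u by (intro divide_right_mono mult_left_mono power_increasing C(1)) auto
      finally show "\<bar>E j m / fact m * ?T j (n - m) u\<bar> \<le>
         \<bar>E j m / fact m\<bar> * (C j (n - m) * (1 + ln u) ^ n / u ^ (J + 1))"
        unfolding abs_mult [of "_ / _"] by (intro mult_left_mono) auto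
    qed
    finally show "\<bar>expansion J n (u - 1) - u * expansion_deriv J (Suc n) u\<bar> \<le>
      (\<Sum>j\<le>J. \<Sum>m\<le>n. \<bar>E j m / fact m\<bar> * C j (n - m)) * (1 + ln u) ^ n / u ^ (J + 1)"
      by (simp only: sum_distrib_right sum_divide_distrib mult.assoc times_divide_eq_right)
  qed (auto intro!: sum_nonneg mult_nonneg_nonneg divide_nonneg_nonneg C(1))
qed

subsection \<open>Comparison with the expansion\<close>

text \<open>Use x^p/p! \<le> e^x at x = (1 + ln u)/2, where e^x is a multiple of sqrt u.\<close>

lemma ln_power_le_sqrt:
  obtains C where "C \<ge> 0" "\<And>u::real. u \<ge> 1 \<Longrightarrow> (1 + ln u) ^ p \<le> C * sqrt u"
proof (rule that[of "2 ^ p * fact p * exp (1 / 2)"])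
  fix u :: real assume u: "u \<ge> 1"
  have "((1 + ln u) / 2) ^ p / fact p \<le> exp ((1 + ln u) / 2)"
    using u by (intro power_le_fact_times_exp) auto
  also have "\<dots> = exp (1 / 2) * sqrt u"
    using u by (simp add: add_divide_distrib exp_add powr_half_sqrt [symmetric] powr_def)
  finally show "(1 + ln u) ^ p \<le> 2 ^ p * fact p * exp (1 / 2) * sqrt u"
    by (simp add: power_divide field_simps)
qed simp

lemma ln_power_over_power_le:
  obtains C where "C \<ge> 0" "\<And>u::real. u \<ge> 1 \<Longrightarrow> (1 + ln u) ^ p / u ^ Suc j \<le> C * u powr (- 1 / 2)"
proof -
  obtain C where C: "C \<ge> 0" "\<And>u::real. u \<ge> 1 \<Longrightarrow> (1 + ln u) ^ p \<le> C * sqrt u"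
    using ln_power_le_sqrt by blast
  show ?thesis
  proof (rule that[OF C(1)])
    fix u :: real assume u: "u \<ge> 1"
    have "(1 + ln u) ^ p / u ^ Suc j \<le> C * sqrt u / u ^ 1"
      using u C(1) by (intro frac_le C(2) power_increasing) auto
    also have "\<dots> = C * u powr (- 1 / 2)"
      using u by (simp add: powr_minus powr_half_sqrt real_sqrt_divide field_simps)
    finally show "(1 + ln u) ^ p / u ^ Suc j \<le> C * u powr (- 1 / 2)" .
  qed
qed

lemma powr_minus_half_tendsto_0: "((\<lambda>u::real. u powr (- 1 / 2)) \<longlongrightarrow> 0) at_top"
  by (rule tendsto_neg_powr) (auto intro: filterlim_ident)

text \<open>\<open>W\<close> is an explicit majorant for the tail integral of |R'|: both R + W and W
  - R are nonincreasing. As W tends to 0, R has a limit c and stays within W of it.\<close>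

lemma limit_of_derivative_bound:
  fixes R R' :: "real \<Rightarrow> real"
  assumes a: "a \<ge> 1" and B: "B \<ge> 0"
    and deriv: "\<And>u. u \<ge> a \<Longrightarrow> (R has_real_derivative R' u) (at u)"
    and bound: "\<And>u. u \<ge> a \<Longrightarrow> \<bar>R' u\<bar> \<le> B * (1 + ln u) ^ p / u ^ Suc (Suc j)"
  obtains b c C where "b \<ge> a" "C \<ge> 0" "\<And>u. u \<ge> b \<Longrightarrow> \<bar>R u - c\<bar> \<le> C * (1 + ln u) ^ p / u ^ Suc j"
proof -
  \<comment> \<open>From \<open>exp (2 * real p)\<close> on, differentiating the logarithmic power
    takes back at most half of the main term of W'; the factor 2 in \<open>W\<close> makes up for
    it.\<close>
  define b where "b = max a (exp (2 * real p))"
  define W where "W = (\<lambda>u. 2 * B * (1 + ln u) ^ p / u ^ Suc j)"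
  define W' where "W' = (\<lambda>u. 2 * B * (real p * (1 + ln u) ^ (p - 1) - real (Suc j) * (1 + ln u) ^ p) / u ^ Suc (Suc j))"
  have b: "b \<ge> a" "b \<ge> 1" using a by (auto simp: b_def)
  have W_nonneg: "W u \<ge> 0" if "u \<ge> b" for u
    using that b B by (auto simp: W_def)
  have W_deriv: "(W has_real_derivative W' u) (at u)" if "u \<ge> b" for u
  proof -
    have u: "u > 0" using that b by simp
    have "(W has_real_derivative (2 * B * (real p * (1 + ln u) ^ (p - 1) * (1 / u)) * u ^ Suc j -
       2 * B * (1 + ln u) ^ p * (real (Suc j) * u ^ j)) / (u ^ Suc j * u ^ Suc j)) (at u)"
      unfolding W_def using u by (auto intro!: derivative_eq_intros simp del: power_Suc of_nat_Suc)
    also have "(2 * B * (real p * (1 + ln u) ^ (p - 1) * (1 / u)) * u ^ Suc j -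
       2 * B * (1 + ln u) ^ p * (real (Suc j) * u ^ j)) / (u ^ Suc j * u ^ Suc j) = W' u"
      unfolding W'_def using u by (simp add: field_simps del: of_nat_Suc)
    finally show ?thesis .
  qed
  have W'_le: "W' u \<le> - (B * (1 + ln u) ^ p / u ^ Suc (Suc j))" if "u \<ge> b" for u
  proof -
    define L where "L = 1 + ln u"
    have u: "u > 0" using that b by simp
    have "exp (2 * real p) \<le> u" using that by (simp add: b_def)
    hence "2 * real p \<le> ln u" using u by (simp add: ln_ge_iff)
    hence L: "L \<ge> 2 * real p" "L \<ge> 1" by (auto simp: L_def)
    have "2 * (real p * L ^ (p - 1)) \<le> L ^ p"
    proof (cases p)
      case (Suc q)
      have "(2 * real p) * L ^ q \<le> L * L ^ q"
        using L by (intro mult_right_mono) auto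
      thus ?thesis by (simp add: Suc mult.assoc del: of_nat_Suc)
    qed simp
    moreover have "L ^ p \<le> real (Suc j) * L ^ p"
      using L mult_right_mono[of 1 "real (Suc j)" "L ^ p"] by simp
    moreover have "2 * (x - y) \<le> - z" if "2 * x \<le> z" "z \<le> y" for x y z :: real
      using that by argo
    ultimately have "2 * (real p * L ^ (p - 1) - real (Suc j) * L ^ p) \<le> - (L ^ p)"
      by blast
    hence "B * (2 * (real p * L ^ (p - 1) - real (Suc j) * L ^ p)) / u ^ Suc (Suc j) \<le> B * (- (L ^ p)) / u ^ Suc (Suc j)"
      using B u by (intro divide_right_mono mult_left_mono) auto
    thus ?thesis by (simp add: W'_def L_def mult_ac)
  qed
  have diff: "\<bar>R v - R u\<bar> \<le> W u" if "b \<le> u" "u \<le> v" for u v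
  proof -
    have "R v + W v \<le> R u + W u"
    proof (rule DERIV_nonpos_imp_nonincreasing [OF that(2)])
      fix x assume "u \<le> x"
      hence x: "b \<le> x" "a \<le> x" using that b by auto
      have "((\<lambda>x. R x + W x) has_real_derivative R' x + W' x) (at x)"
        by (intro DERIV_add deriv W_deriv x)
      moreover have "R' x + W' x \<le> 0" using bound[OF x(2)] W'_le[OF x(1)] by linarith
      ultimately show "\<exists>y. ((\<lambda>x. R x + W x) has_real_derivative y) (at x) \<and> y \<le> 0" by blast
    qed
    moreover have "W v - R v \<le> W u - R u"
    proof (rule DERIV_nonpos_imp_nonincreasing [OF that(2)])
      fix x assume "u \<le> x"
      hence x: "b \<le> x" "a \<le> x" using that b by auto
      have "((\<lambda>x. W x - R x) has_real_derivative W' x - R' x) (at x)"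
        by (intro DERIV_diff deriv W_deriv x)
      moreover have "W' x - R' x \<le> 0" using bound[OF x(2)] W'_le[OF x(1)] by linarith
      ultimately show "\<exists>y. ((\<lambda>x. W x - R x) has_real_derivative y) (at x) \<and> y \<le> 0" by blast
    qed
    moreover have "W v \<ge> 0" using that by (intro W_nonneg) auto
    ultimately show ?thesis by linarith
  qed
  have W_lim: "(W \<longlongrightarrow> 0) at_top"
  proof -
    obtain C where C: "C \<ge> 0" "\<And>u::real. u \<ge> 1 \<Longrightarrow> (1 + ln u) ^ p / u ^ Suc j \<le> C * u powr (- 1 / 2)"
      using ln_power_over_power_le by blast
    show ?thesis
    proof (rule tendsto_sandwich [where f = "\<lambda>_. 0"])
      show "((\<lambda>u::real. 2 * B * C * u powr (- 1 / 2)) \<longlongrightarrow> 0) at_top"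
        using tendsto_mult_right_zero [OF powr_minus_half_tendsto_0] .
      show "eventually (\<lambda>u. 0 \<le> W u) at_top"
        using eventually_ge_at_top[of b] by eventually_elim (rule W_nonneg)
      show "eventually (\<lambda>u. W u \<le> 2 * B * C * u powr (- 1 / 2)) at_top"
        using eventually_ge_at_top[of 1]
      proof eventually_elim
        case (elim u)
        have "2 * B * ((1 + ln u) ^ p / u ^ Suc j) \<le> 2 * B * (C * u powr (- 1 / 2))"
          using B elim by (intro mult_left_mono C(2)) auto
        thus ?case by (simp add: W_def mult_ac)
      qed
    qed simp
  qed
  \<comment> \<open>Convergence along the integers is enough: \<open>diff\<close> carries the limit
    over to all real u \<ge> b.\<close>
  have "Cauchy (\<lambda>n. R (real n))"
  proof (rule CauchyI)
    fix e :: real assume "e > 0"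
    hence "eventually (\<lambda>u. W u < e) at_top"
      using W_lim by (auto dest: order_tendstoD)
    hence "eventually (\<lambda>u. W u < e \<and> u \<ge> b) at_top"
      by (intro eventually_conj eventually_ge_at_top)
    then obtain N where N: "\<And>u. u \<ge> N \<Longrightarrow> W u < e \<and> u \<ge> b"
      by (auto simp: eventually_at_top_linorder)
    show "\<exists>M. \<forall>m\<ge>M. \<forall>n\<ge>M. norm (R (real m) - R (real n)) < e"
    proof (intro exI allI impI)
      fix m n assume mn: "m \<ge> nat \<lceil>N\<rceil>" "n \<ge> nat \<lceil>N\<rceil>"
      hence "real m \<ge> N" "real n \<ge> N" by linarith+
      thus "norm (R (real m) - R (real n)) < e"
        using N[of "real m"] N[of "real n"] diff[of "real m" "real n"] diff[of "real n" "real m"]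
        by (cases "m \<le> n") auto
    qed
  qed
  then obtain c where c: "(\<lambda>n. R (real n)) \<longlonglongrightarrow> c"
    using Cauchy_convergent_iff convergent_def by blast
  show ?thesis
  proof (rule that[of b "2 * B" c])
    fix u assume u: "u \<ge> b"
    have "(\<lambda>n. \<bar>R u - R (real n)\<bar>) \<longlonglongrightarrow> \<bar>R u - c\<bar>"
      by (intro tendsto_intros c)
    moreover have "eventually (\<lambda>n. \<bar>R u - R (real n)\<bar> \<le> W u) sequentially"
      using eventually_ge_at_top[of "nat \<lceil>u\<rceil>"]
    proof eventually_elim
      case (elim n)
      hence "real n \<ge> u" by linarith
      from diff[OF u this] show ?case by linarith
    qed
    ultimately have "\<bar>R u - c\<bar> \<le> W u"
      by (intro tendsto_upperbound) auto
    thus "\<bar>R u - c\<bar> \<le> 2 * B * (1 + ln u) ^ p / u ^ Suc j" by (simp add: W_def)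
  qed (use b B in auto)
qed

section \<open>Bounds on the half-line and Laplace transforms as s tends to 0\<close>

lemma E_at_0: "E 0 m = (if m = 0 then 1 else 0)"
  by (simp add: E_eq_fps_nth fps_nth_power_0 fps_Ein_def)

text \<open>Ein has no constant term, so in the row j = 0 only m = 0 survives and gives Q_l; all
  rows with a derivative decay. The crude rate u^(-1/2) is the one
  \<open>Laplace_transform_bound\<close> takes.\<close>

lemma expansion_approx_log_poly:
  obtains C where "C \<ge> 0" "\<And>u. u \<ge> 1 \<Longrightarrow> \<bar>expansion J l u - log_poly l (ln u)\<bar> \<le> C * u powr (- 1 / 2)"
proof -
  have "\<exists>C\<ge>0. \<forall>u\<ge>1. \<bar>log_poly_deriv (Suc j) k u\<bar> \<le> C * u powr (- 1 / 2)" for j k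
  proof -
    obtain C where C: "C \<ge> 0" "\<And>u. u \<ge> 1 \<Longrightarrow> \<bar>log_poly_deriv (Suc j) k u\<bar> \<le> C * (1 + ln u) ^ k / u ^ Suc j"
      using log_poly_deriv_bound by blast
    obtain D where D: "D \<ge> 0" "\<And>u::real. u \<ge> 1 \<Longrightarrow> (1 + ln u) ^ k / u ^ Suc j \<le> D * u powr (- 1 / 2)"
      using ln_power_over_power_le by blast
    have "\<bar>log_poly_deriv (Suc j) k u\<bar> \<le> C * D * u powr (- 1 / 2)" if "u \<ge> 1" for u
    proof -
      have "\<bar>log_poly_deriv (Suc j) k u\<bar> \<le> C * ((1 + ln u) ^ k / u ^ Suc j)"
        using C(2)[OF that] by simp
      also have "\<dots> \<le> C * (D * u powr (- 1 / 2))"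
        by (intro mult_left_mono D(2) that C(1))
      finally show ?thesis by (simp add: mult_ac)
    qed
    thus ?thesis using C(1) D(1) by (intro exI[of _ "C * D"]) auto
  qed
  hence "\<forall>j k. \<exists>C\<ge>0. \<forall>u\<ge>1. \<bar>log_poly_deriv (Suc j) k u\<bar> \<le> C * u powr (- 1 / 2)"
    by blast
  then obtain C where C: "\<And>j k. C j k \<ge> 0"
    "\<And>j k u. u \<ge> 1 \<Longrightarrow> \<bar>log_poly_deriv (Suc j) k u\<bar> \<le> C j k * u powr (- 1 / 2)"
    unfolding choice_iff by blast
  show ?thesis
  proof (rule that[of "\<Sum>j<J. \<Sum>m\<le>l. \<bar>E (Suc j) m / fact m\<bar> * C j (l - m)"])
    fix u :: real assume u: "u \<ge> 1"
    have "(\<Sum>m\<le>l. E 0 m / fact m * log_poly_deriv 0 (l - m) u) = (\<Sum>m\<le>l. if m = 0 then log_poly l (ln u) else 0)"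
      by (rule sum.cong) (auto simp: E_at_0 log_poly_deriv_0)
    hence "expansion J l u - log_poly l (ln u) =
        (\<Sum>j<J. \<Sum>m\<le>l. E (Suc j) m / fact m * log_poly_deriv (Suc j) (l - m) u)"
      unfolding expansion_def by (subst sum.atMost_shift) simp
    hence "\<bar>expansion J l u - log_poly l (ln u)\<bar> =
        \<bar>\<Sum>j<J. \<Sum>m\<le>l. E (Suc j) m / fact m * log_poly_deriv (Suc j) (l - m) u\<bar>"
      by (rule arg_cong)
    also have "\<dots> \<le> (\<Sum>j<J. \<bar>\<Sum>m\<le>l. E (Suc j) m / fact m * log_poly_deriv (Suc j) (l - m) u\<bar>)"
      by (rule sum_abs)
    also have "\<dots> \<le> (\<Sum>j<J. \<Sum>m\<le>l. \<bar>E (Suc j) m / fact m * log_poly_deriv (Suc j) (l - m) u\<bar>)"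
      by (intro sum_mono sum_abs)
    also have "\<dots> \<le> (\<Sum>j<J. \<Sum>m\<le>l. \<bar>E (Suc j) m / fact m\<bar> * (C j (l - m) * u powr (- 1 / 2)))"
      unfolding abs_mult [of "_ / _"] by (intro sum_mono mult_left_mono C(2) u) auto
    finally show "\<bar>expansion J l u - log_poly l (ln u)\<bar> \<le>
       (\<Sum>j<J. \<Sum>m\<le>l. \<bar>E (Suc j) m / fact m\<bar> * C j (l - m)) * u powr (- 1 / 2)"
      by (simp only: sum_distrib_right mult.assoc)
  qed (auto intro!: sum_nonneg mult_nonneg_nonneg divide_nonneg_nonneg C(1))
qed

lemma abs_ln_power_le:
  fixes u :: real
  assumes "u > 0"
  shows "\<bar>ln u\<bar> ^ k \<le> 2 ^ k * fact k * (u powr (1 / 2) + u powr (- 1 / 2))"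
proof -
  have "(\<bar>ln u\<bar> / 2) ^ k / fact k \<le> u powr (1 / 2) + u powr (- 1 / 2)"
    using power_le_fact_times_exp[of "\<bar>ln u\<bar> / 2" k] exp_half_abs_ln_le [OF assms] by simp
  thus ?thesis by (simp add: power_divide divide_le_eq mult_ac)
qed

lemma log_poly_ln_bound:
  obtains C where "C \<ge> 0" "\<And>u. u > 0 \<Longrightarrow> \<bar>log_poly k (ln u)\<bar> \<le> C * (u powr (1 / 2) + u powr (- 1 / 2))"
proof (rule that[of "\<Sum>r\<le>k. \<bar>(-1) ^ r * Cc r / fact (k - r)\<bar> * (2 ^ (k - r) * fact (k - r))"])
  fix u :: real assume u: "u > 0"
  have "\<bar>log_poly k (ln u)\<bar> \<le> (\<Sum>r\<le>k. \<bar>(-1) ^ r * Cc r / fact (k - r) * ln u ^ (k - r)\<bar>)"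
    unfolding log_poly_altdef by (rule sum_abs)
  also have "\<dots> \<le> (\<Sum>r\<le>k. \<bar>(-1) ^ r * Cc r / fact (k - r)\<bar> *
      (2 ^ (k - r) * fact (k - r) * (u powr (1 / 2) + u powr (- 1 / 2))))"
    unfolding abs_mult [of "_ / _"] power_abs by (intro sum_mono mult_left_mono abs_ln_power_le u) auto
  finally show "\<bar>log_poly k (ln u)\<bar> \<le>
     (\<Sum>r\<le>k. \<bar>(-1) ^ r * Cc r / fact (k - r)\<bar> * (2 ^ (k - r) * fact (k - r))) * (u powr (1 / 2) + u powr (- 1 / 2))"
    by (simp only: sum_distrib_right mult.assoc)
qed (auto intro!: sum_nonneg mult_nonneg_nonneg divide_nonneg_nonneg)

lemma K_bounded_on_atMost:
  obtains D where "D \<ge> 0" "\<And>u. u \<le> b \<Longrightarrow> \<bar>K l u\<bar> \<le> D"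
proof -
  have "bounded (delay_K l ` {real l..b})"
    by (intro compact_imp_bounded compact_continuous_image continuous_on_subset [OF continuous_on_delay_K]) auto
  then obtain D where "\<forall>y\<in>delay_K l ` {real l..b}. norm y \<le> D"
    unfolding bounded_iff by blast
  hence D: "\<bar>delay_K l u\<bar> \<le> D" if "u \<in> {real l..b}" for u
    using that by auto
  show ?thesis
  proof (rule that[of "max D 0"])
    fix u assume "u \<le> b"
    thus "\<bar>K l u\<bar> \<le> max D 0"
      using D[of u] by (cases "u < real l") (auto simp: K_eq_delay_K delay_K_eq_0)
  qed simp
qed

lemma Laplace_transform_difference:
  assumes "s > 0" "\<And>u. u > 0 \<Longrightarrow> \<bar>K l u - log_poly l (ln u) - c\<bar> \<le> B * u powr (- 1 / 2)"
  shows "\<bar>exp_integral_E1 s ^ l / fact l - (- euler_mascheroni - ln s) ^ l / fact l - c\<bar> \<le> B * sqrt pi * sqrt s"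
proof (rule Laplace_transform_bound [OF assms(1) _ assms(2)])
  \<comment> \<open>A constant is treated as a multiple of \<open>log_poly 0\<close>, whose
    transform is 1.\<close>
  have one: "log_poly 0 x = 1" for x by (simp add: log_poly_altdef Cc_0)
  have "has_bochner_integral lborel (\<lambda>u. indicator {0<..} u * (s * exp (- s * u) * K l u) -
      indicator {0<..} u * (s * exp (- s * u) * log_poly l (ln u)) -
      c * (indicator {0<..} u * (s * exp (- s * u) * log_poly 0 (ln u))))
      (exp_integral_E1 s ^ l / fact l - (- euler_mascheroni - ln s) ^ l / fact l -
       c * ((- euler_mascheroni - ln s) ^ 0 / fact 0))"
    by (intro has_bochner_integral_diff has_bochner_integral_mult_right
        Laplace_transform_K Laplace_transform_log_poly assms(1))
  thus "has_bochner_integral lborel (\<lambda>u. indicator {0<..} u * (s * exp (- s * u) * (K l u - log_poly l (ln u) - c)))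
      (exp_integral_E1 s ^ l / fact l - (- euler_mascheroni - ln s) ^ l / fact l - c)"
    by (simp add: one algebra_simps)
qed

lemma K_1: "K (Suc 0) u = (if u < 1 then 0 else ln u)"
proof (cases "u < 1")
  case False
  have "((\<lambda>v. 1 / v) has_integral ln u - ln 1) {1..u}"
    using False by (intro fundamental_theorem_of_calculus)
      (auto intro!: derivative_eq_intros simp flip: has_real_derivative_iff_has_vector_derivative)
  hence "((\<lambda>v. delay_K 0 (v - 1) / v) has_integral ln u) {1..u}"
    by (subst has_integral_cong [where g = "\<lambda>v. 1 / v"]) auto
  thus ?thesis using False by (simp add: K_eq_delay_K integral_unique)
qed (simp add: K_eq_delay_K)

text \<open>The transform comparison for l = 1 and c = 0: \<open>K 1\<close> and
  \<open>log_poly 1\<close> at ln u differ only for u < 1, where |ln u| \<le> 2 u^(-1/2).\<close>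

lemma exp_integral_E1_approx:
  obtains B where "B \<ge> 0"
    "\<And>s. s > 0 \<Longrightarrow> \<bar>exp_integral_E1 s - (- euler_mascheroni - ln s)\<bar> \<le> B * sqrt s"
proof -
  have "\<bar>K 1 u - log_poly 1 (ln u) - 0\<bar> \<le> 2 * u powr (- 1 / 2)" if u: "u > 0" for u
  proof (cases "u < 1")
    case True
    have "\<bar>ln u\<bar> / 2 \<le> exp (\<bar>ln u\<bar> / 2)"
      using exp_ge_add_one_self[of "\<bar>ln u\<bar> / 2"] by linarith
    also have "\<dots> = u powr (- 1 / 2)"
      using u True by (simp add: powr_def abs_if)
    finally show ?thesis using True
      by (simp add: K_1 log_poly_altdef Cc_0 Cc_1)
  qed (use u in \<open>simp add: K_1 log_poly_altdef Cc_0 Cc_1\<close>)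
  hence "\<bar>exp_integral_E1 s - (- euler_mascheroni - ln s)\<bar> \<le> 2 * sqrt pi * sqrt s" if "s > 0" for s
    using Laplace_transform_difference[of s 1 0 2] that by simp
  thus ?thesis by (intro that[of "2 * sqrt pi"]) auto
qed

lemma abs_power_diff_le:
  fixes a b M :: real
  assumes "\<bar>a\<bar> \<le> M" "\<bar>b\<bar> \<le> M" "M \<ge> 1"
  shows "\<bar>a ^ l - b ^ l\<bar> \<le> real l * M ^ l * \<bar>a - b\<bar>"
proof (induction l)
  case (Suc l)
  have "a ^ Suc l - b ^ Suc l = a * (a ^ l - b ^ l) + (a - b) * b ^ l"
    by (simp add: algebra_simps)
  also have "\<bar>\<dots>\<bar> \<le> \<bar>a\<bar> * \<bar>a ^ l - b ^ l\<bar> + \<bar>a - b\<bar> * \<bar>b\<bar> ^ l"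
    by (rule order_trans [OF abs_triangle_ineq]) (simp add: abs_mult power_abs)
  also have "\<dots> \<le> M * (real l * M ^ l * \<bar>a - b\<bar>) + \<bar>a - b\<bar> * M ^ Suc l"
  proof (intro add_mono mult_mono mult_left_mono Suc)
    have "\<bar>b\<bar> ^ l \<le> M ^ l" using assms by (intro power_mono) auto
    also have "\<dots> \<le> M ^ Suc l" using assms by (intro power_increasing) auto
    finally show "\<bar>b\<bar> ^ l \<le> M ^ Suc l" .
  qed (use assms in auto)
  also have "\<dots> = real (Suc l) * M ^ Suc l * \<bar>a - b\<bar>"
    by (simp add: algebra_simps)
  finally show ?case .
qed simp

lemma exp_decay_beats_power:
  assumes "D \<ge> 0"
  shows "(\<lambda>n. exp (- real n / 2) * (real n + D) ^ l) \<longlonglongrightarrow> 0"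
proof (rule tendsto_sandwich [where f = "\<lambda>_. 0"])
  have "(\<lambda>n. exp (- 1 / 4) ^ n :: real) \<longlonglongrightarrow> 0"
    by (rule LIMSEQ_realpow_zero) auto
  hence "(\<lambda>n. 4 ^ l * fact l * exp (D / 4) * exp (- 1 / 4) ^ n :: real) \<longlonglongrightarrow> 0"
    by (rule tendsto_mult_right_zero)
  thus "(\<lambda>n. 4 ^ l * fact l * exp (D / 4) * exp (- real n / 4)) \<longlonglongrightarrow> 0"
    by (simp flip: exp_of_nat_mult)
  show "eventually (\<lambda>n. exp (- real n / 2) * (real n + D) ^ l \<le> 4 ^ l * fact l * exp (D / 4) * exp (- real n / 4)) sequentially"
  proof (intro always_eventually allI)
    fix n
    have "((real n + D) / 4) ^ l / fact l \<le> exp ((real n + D) / 4)"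
      using assms by (intro power_le_fact_times_exp) auto
    hence "(real n + D) ^ l \<le> 4 ^ l * fact l * exp ((real n + D) / 4)"
      by (simp add: power_divide divide_le_eq mult_ac)
    hence "exp (- real n / 2) * (real n + D) ^ l \<le> exp (- real n / 2) * (4 ^ l * fact l * exp ((real n + D) / 4))"
      by (intro mult_left_mono) auto
    also have "\<dots> = 4 ^ l * fact l * (exp (- real n / 2) * exp ((real n + D) / 4))"
      by simp
    also have "exp (- real n / 2) * exp ((real n + D) / 4) = exp (D / 4) * exp (- real n / 4)"
      by (simp flip: exp_add) (simp add: field_simps)
    finally show "exp (- real n / 2) * (real n + D) ^ l \<le> 4 ^ l * fact l * exp (D / 4) * exp (- real n / 4)"
      by simp
  qed
qed (use assms in auto)

text \<open>The l-th powers of E_1(s) and -\<gamma> - ln s differ by a multiple of sqrt s times a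
  power of the logarithm, which tends to 0, while \<open>Laplace_transform_difference\<close> forces
  their difference over l! to tend to c.\<close>

lemma constant_eq_0:
  assumes "\<And>u. u > 0 \<Longrightarrow> \<bar>K l u - log_poly l (ln u) - c\<bar> \<le> B * u powr (- 1 / 2)"
  shows "c = 0"
proof -
  obtain A where A: "A \<ge> 0"
    "\<And>s. s > 0 \<Longrightarrow> \<bar>exp_integral_E1 s - (- euler_mascheroni - ln s)\<bar> \<le> A * sqrt s"
    using exp_integral_E1_approx by blast
  \<comment> \<open>Along this sequence -ln s is n and sqrt s is e^(-n/2), so exponential decay
    faces powers of n.\<close>
  define s where "s = (\<lambda>n. exp (- real n))"
  \<comment> \<open>Makes n + D a bound for both bases, since sqrt s \<le> 1; the summand 1 secures
    n + D \<ge> 1 for \<open>abs_power_diff_le\<close>.\<close>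
  define D where "D = \<bar>euler_mascheroni :: real\<bar> + A + 1"
  have D: "D \<ge> 0" using A(1) by (simp add: D_def)
  have sqrt_s: "sqrt (s n) = exp (- real n / 2)" for n
    by (simp add: s_def powr_half_sqrt [symmetric] powr_def)
  have power_diff: "\<bar>exp_integral_E1 (s n) ^ l - (- euler_mascheroni - ln (s n)) ^ l\<bar> \<le>
     real l * A * (exp (- real n / 2) * (real n + D) ^ l)" for n
  proof -
    have close: "\<bar>exp_integral_E1 (s n) - (- euler_mascheroni - ln (s n))\<bar> \<le> A * exp (- real n / 2)"
      using A(2)[of "s n"] by (simp add: sqrt_s) (simp add: s_def)
    also have "\<dots> \<le> A * 1" using A(1) by (intro mult_left_mono) auto
    finally have "\<bar>exp_integral_E1 (s n)\<bar> \<le> real n + D" "\<bar>- euler_mascheroni - ln (s n)\<bar> \<le> real n + D"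
      using A(1) by (auto simp: D_def s_def)
    hence "\<bar>exp_integral_E1 (s n) ^ l - (- euler_mascheroni - ln (s n)) ^ l\<bar> \<le>
       real l * (real n + D) ^ l * \<bar>exp_integral_E1 (s n) - (- euler_mascheroni - ln (s n))\<bar>"
      using A(1) by (intro abs_power_diff_le) (auto simp: D_def)
    also have "\<dots> \<le> real l * (real n + D) ^ l * (A * exp (- real n / 2))"
      using D by (intro mult_left_mono close) auto
    finally show ?thesis by (simp add: mult_ac)
  qed
  have "(\<lambda>n. real l * A * (exp (- real n / 2) * (real n + D) ^ l)) \<longlonglongrightarrow> 0"
    by (intro tendsto_mult_right_zero exp_decay_beats_power D)
  hence "(\<lambda>n. exp_integral_E1 (s n) ^ l - (- euler_mascheroni - ln (s n)) ^ l) \<longlonglongrightarrow> 0"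
    by (rule Lim_null_comparison [rotated]) (intro always_eventually allI, unfold real_norm_def, rule power_diff)
  hence "(\<lambda>n. (exp_integral_E1 (s n) ^ l - (- euler_mascheroni - ln (s n)) ^ l) / fact l - c) \<longlonglongrightarrow> 0 / fact l - c"
    by (intro tendsto_intros) auto
  moreover have "(\<lambda>n. (exp_integral_E1 (s n) ^ l - (- euler_mascheroni - ln (s n)) ^ l) / fact l - c) \<longlonglongrightarrow> 0"
  proof (rule Lim_null_comparison)
    have "(\<lambda>n. B * sqrt pi * (exp (- real n / 2) * (real n + 0) ^ 0)) \<longlonglongrightarrow> 0"
      by (intro tendsto_mult_right_zero exp_decay_beats_power) auto
    thus "(\<lambda>n. B * sqrt pi * sqrt (s n)) \<longlonglongrightarrow> 0"
      by (simp add: sqrt_s)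
    show "eventually (\<lambda>n. norm ((exp_integral_E1 (s n) ^ l - (- euler_mascheroni - ln (s n)) ^ l) / fact l - c) \<le>
        B * sqrt pi * sqrt (s n)) sequentially"
    proof (intro always_eventually allI)
      fix n
      have "s n > 0" by (simp add: s_def)
      from Laplace_transform_difference [OF this assms]
      show "norm ((exp_integral_E1 (s n) ^ l - (- euler_mascheroni - ln (s n)) ^ l) / fact l - c) \<le>
        B * sqrt pi * sqrt (s n)"
        by (simp add: diff_divide_distrib)
    qed
  qed
  ultimately have "0 / fact l - c = 0"
    by (rule LIMSEQ_unique)
  thus ?thesis by simp
qed


text \<open>The Laplace integral starts at 0, but the expansion is controlled only from b on. Below
  b, \<open>K\<close> is bounded and \<open>log_poly\<close> grows at most like u^(-1/2) at 0, so
  everything fits under u^(-1/2).\<close>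

lemma K_minus_log_poly_bound:
  assumes "b \<ge> 1" "C \<ge> 0"
    and "\<And>u. u \<ge> b \<Longrightarrow> \<bar>K l u - expansion J l u - c\<bar> \<le> C * (1 + ln u) ^ p / u ^ Suc J"
  obtains B where "\<And>u. u > 0 \<Longrightarrow> \<bar>K l u - log_poly l (ln u) - c\<bar> \<le> B * u powr (- 1 / 2)"
proof -
  obtain C1 where C1: "C1 \<ge> 0"
    "\<And>u::real. u \<ge> 1 \<Longrightarrow> (1 + ln u) ^ p / u ^ Suc J \<le> C1 * u powr (- 1 / 2)"
    using ln_power_over_power_le by blast
  obtain C2 where C2: "C2 \<ge> 0"
    "\<And>u. u \<ge> 1 \<Longrightarrow> \<bar>expansion J l u - log_poly l (ln u)\<bar> \<le> C2 * u powr (- 1 / 2)"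
    using expansion_approx_log_poly by blast
  obtain C3 where C3: "C3 \<ge> 0"
    "\<And>u. u > 0 \<Longrightarrow> \<bar>log_poly l (ln u)\<bar> \<le> C3 * (u powr (1 / 2) + u powr (- 1 / 2))"
    using log_poly_ln_bound by blast
  obtain D where D: "D \<ge> 0" "\<And>u. u \<le> b \<Longrightarrow> \<bar>K l u\<bar> \<le> D"
    using K_bounded_on_atMost by blast
  \<comment> \<open>The first entry serves u \<ge> b; the second serves u < b, through u^(1/2) \<le>
    b u^(-1/2) and 1 \<le> b u^(-1/2).\<close>
  define B where "B = max (C * C1 + C2) (C3 * (b + 1) + (D + \<bar>c\<bar>) * b)"
  show ?thesis
  proof (rule that[of B])
    fix u :: real assume u: "u > 0"
    show "\<bar>K l u - log_poly l (ln u) - c\<bar> \<le> B * u powr (- 1 / 2)"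
    proof (cases "u \<ge> b")
      case True
      hence u1: "u \<ge> 1" using assms(1) by simp
      have "C * ((1 + ln u) ^ p / u ^ Suc J) \<le> C * (C1 * u powr (- 1 / 2))"
        by (intro mult_left_mono C1(2) u1 assms(2))
      hence "\<bar>K l u - log_poly l (ln u) - c\<bar> \<le> C * (C1 * u powr (- 1 / 2)) + C2 * u powr (- 1 / 2)"
        using assms(3)[OF True] C2(2)[OF u1] by (simp only: times_divide_eq_right)
      also have "\<dots> = (C * C1 + C2) * u powr (- 1 / 2)"
        by (simp add: algebra_simps)
      also have "\<dots> \<le> B * u powr (- 1 / 2)"
        unfolding B_def by (intro mult_right_mono) auto
      finally show ?thesis .
    next
      case False
      have half: "u powr (1 / 2) = u * u powr (- 1 / 2)"
        using u powr_add[of u 1 "- 1 / 2"] by simp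
      have "u * u powr (- 1 / 2) \<le> b * u powr (- 1 / 2)"
        using False by (intro mult_right_mono) auto
      hence "C3 * (u powr (1 / 2) + u powr (- 1 / 2)) \<le> C3 * (b * u powr (- 1 / 2) + u powr (- 1 / 2))"
        unfolding half by (intro mult_left_mono C3(1)) simp
      moreover have "1 \<le> b * u powr (- 1 / 2)"
      proof -
        have "1 = (u powr (1 / 2)) * u powr (- 1 / 2)"
          using u powr_add[of u "1 / 2" "- 1 / 2"] by simp
        also have "u powr (1 / 2) \<le> b powr (1 / 2)"
          using u False by (intro powr_mono2) auto
        also have "b powr (1 / 2) \<le> b powr 1"
          using assms(1) by (intro powr_mono) auto
        finally show ?thesis using assms(1) by (simp add: mult_right_mono)
      qed
      hence "D + \<bar>c\<bar> \<le> (D + \<bar>c\<bar>) * (b * u powr (- 1 / 2))"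
        using D(1) mult_left_mono[of 1 "b * u powr (- 1 / 2)" "D + \<bar>c\<bar>"] by simp
      moreover have "\<bar>K l u\<bar> \<le> D"
        using D(2)[of u] False by simp
      ultimately have "\<bar>K l u - log_poly l (ln u) - c\<bar> \<le>
          C3 * (b * u powr (- 1 / 2) + u powr (- 1 / 2)) + (D + \<bar>c\<bar>) * (b * u powr (- 1 / 2))"
        using C3(2)[OF u] by linarith
      also have "\<dots> = (C3 * (b + 1) + (D + \<bar>c\<bar>) * b) * u powr (- 1 / 2)"
        by (simp add: algebra_simps)
      also have "\<dots> \<le> B * u powr (- 1 / 2)"
        unfolding B_def by (intro mult_right_mono) auto
      finally show ?thesis .
    qed
  qed
qed

lemma bound_extends_to_compact:
  fixes R :: "real \<Rightarrow> real"
  assumes "a \<ge> 1" "continuous_on {a..b} R" "C \<ge> 0"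
    and "\<And>u. u \<ge> b \<Longrightarrow> \<bar>R u\<bar> \<le> C * (1 + ln u) ^ p / u ^ q"
  obtains B where "B \<ge> 0" "\<And>u. u \<ge> a \<Longrightarrow> \<bar>R u\<bar> \<le> B * (1 + ln u) ^ p / u ^ q"
proof -
  have "bounded (R ` {a..b})"
    by (intro compact_imp_bounded compact_continuous_image assms) auto
  then obtain D where "\<forall>y\<in>R ` {a..b}. norm y \<le> D"
    unfolding bounded_iff by blast
  define d where "d = max 0 D"
  have d: "\<bar>R u\<bar> \<le> d" if "u \<in> {a..b}" for u
    using that \<open>\<forall>y\<in>_. _\<close> by (force simp: d_def)
  have "d \<ge> 0" by (simp add: d_def)
  show ?thesis
  \<comment> \<open>For u < b the function R is at most \<open>d\<close> and the weight is at least
    b^(-q), hence \<open>d * b ^ q\<close>.\<close>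
  proof (rule that[of "max C (d * b ^ q)"])
    fix u assume u: "u \<ge> a"
    have nonneg: "(1 + ln u) ^ p / u ^ q \<ge> 0" using u assms(1) by auto
    show "\<bar>R u\<bar> \<le> max C (d * b ^ q) * (1 + ln u) ^ p / u ^ q"
    proof (cases "u \<ge> b")
      case True
      have "\<bar>R u\<bar> \<le> C * ((1 + ln u) ^ p / u ^ q)" using assms(4)[OF True] by simp
      also have "\<dots> \<le> max C (d * b ^ q) * ((1 + ln u) ^ p / u ^ q)"
        by (intro mult_right_mono nonneg) auto
      finally show ?thesis by simp
    next
      case False
      have "1 * 1 \<le> (b ^ q / u ^ q) * (1 + ln u) ^ p"
        using False u assms(1) by (intro mult_mono one_le_power) (auto intro!: power_mono simp: le_divide_eq)
      hence "d * (1 * 1) \<le> d * ((b ^ q / u ^ q) * (1 + ln u) ^ p)"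
        by (intro mult_left_mono \<open>d \<ge> 0\<close>)
      hence "\<bar>R u\<bar> \<le> d * b ^ q * ((1 + ln u) ^ p / u ^ q)"
        using d[of u] u False by (simp add: field_simps)
      also have "\<dots> \<le> max C (d * b ^ q) * ((1 + ln u) ^ p / u ^ q)"
        by (intro mult_right_mono nonneg) auto
      finally show ?thesis by simp
    qed
  qed (use assms(3) in auto)
qed

text \<open>To be read with x = K_n(u - 1), y the expansion at u - 1 and z the derivative of the
  next expansion. The factor \<open>2 ^ q\<close> comes from u - 1 \<ge> u/2.\<close>

lemma delay_step_bound:
  fixes x y z u :: real
  assumes "u \<ge> 2" "\<bar>x - y\<bar> \<le> B * (1 + ln (u - 1)) ^ n / (u - 1) ^ q" "B \<ge> 0"
    and "\<bar>y - u * z\<bar> \<le> C * (1 + ln u) ^ n / u ^ q"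
  shows "\<bar>x / u - z\<bar> \<le> (B * 2 ^ q + C) * (1 + ln u) ^ n / u ^ Suc q"
proof -
  have "B * (1 + ln (u - 1)) ^ n / (u - 1) ^ q \<le> B * (1 + ln u) ^ n / (u / 2) ^ q"
    using assms(1,3) by (intro frac_le mult_left_mono power_mono mult_nonneg_nonneg) auto
  hence "\<bar>x - y\<bar> \<le> B * 2 ^ q * (1 + ln u) ^ n / u ^ q"
    using assms(2) by (simp add: power_divide mult_ac)
  hence "\<bar>x - u * z\<bar> \<le> B * 2 ^ q * (1 + ln u) ^ n / u ^ q + C * (1 + ln u) ^ n / u ^ q"
    using assms(4) by linarith
  also have "\<dots> = (B * 2 ^ q + C) * (1 + ln u) ^ n / u ^ q"
    by (simp add: add_divide_distrib algebra_simps)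
  finally have "\<bar>x - u * z\<bar> / u \<le> (B * 2 ^ q + C) * (1 + ln u) ^ n / u ^ q / u"
    using assms(1) by (intro divide_right_mono) auto
  moreover have "\<bar>x / u - z\<bar> = \<bar>x - u * z\<bar> / u"
    using assms(1) by (simp add: field_simps abs_if)
  ultimately show ?thesis by (simp add: mult_ac)
qed

text \<open>The induction starts at l = 0, where the expansion is exact; u \<ge> 1 is asked
  separately to keep the logarithm nonnegative there.\<close>

lemma K_expansion:
  "\<exists>B\<ge>0. \<forall>u. u \<ge> 1 \<and> u \<ge> real l \<longrightarrow> \<bar>K l u - expansion J l u\<bar> \<le> B * (1 + ln u) ^ l / u ^ Suc J"
proof (induction l)
  case 0
  have "expansion J 0 u = log_poly_deriv 0 0 u" for u
    unfolding expansion_def by (subst sum.atMost_shift) (simp add: E_0)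
  hence "expansion J 0 u = 1" for u
    by (simp add: log_poly_deriv_0 log_poly_altdef Cc_0)
  thus ?case by (intro exI[of _ 0]) (auto simp: K_eq_delay_K)
next
  case (Suc n)
  then obtain B where B: "B \<ge> 0"
    "\<And>u. u \<ge> 1 \<Longrightarrow> u \<ge> real n \<Longrightarrow> \<bar>K n u - expansion J n u\<bar> \<le> B * (1 + ln u) ^ n / u ^ Suc J"
    by blast
  obtain C where C: "C \<ge> 0"
    "\<And>u. u \<ge> 2 \<Longrightarrow> \<bar>expansion J n (u - 1) - u * expansion_deriv J (Suc n) u\<bar> \<le> C * (1 + ln u) ^ n / u ^ (J + 1)"
    using expansion_delay_equation by blast
  define R where "R = (\<lambda>u. K (Suc n) u - expansion J (Suc n) u)"
  define R' where "R' = (\<lambda>u. K n (u - 1) / u - expansion_deriv J (Suc n) u)"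
  \<comment> \<open>Starting at n + 2 keeps u beyond \<open>Suc n\<close>, where
    \<open>K (Suc n)\<close> is differentiable, and keeps u - 1 in the range of the induction
    hypothesis.\<close>
  obtain b c C' where b: "b \<ge> real n + 2" and C': "C' \<ge> 0"
    "\<And>u. u \<ge> b \<Longrightarrow> \<bar>R u - c\<bar> \<le> C' * (1 + ln u) ^ n / u ^ Suc J"
  proof (rule limit_of_derivative_bound)
    show "real n + 2 \<ge> 1" by simp
    show "B * 2 ^ Suc J + C \<ge> 0" using B(1) C(1) by simp
    fix u assume u: "u \<ge> real n + 2"
    have "K (Suc n) = delay_K (Suc n)" by (simp add: fun_eq_iff K_eq_delay_K)
    thus "(R has_real_derivative R' u) (at u)"
      unfolding R_def R'_def K_eq_delay_K[of n] using u
      by (auto intro!: DERIV_diff has_real_derivative_delay_K has_real_derivative_expansion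
               simp del: delay_K.simps)
    show "\<bar>R' u\<bar> \<le> (B * 2 ^ Suc J + C) * (1 + ln u) ^ n / u ^ Suc (Suc J)"
      unfolding R'_def
    proof (rule delay_step_bound)
      show "\<bar>expansion J n (u - 1) - u * expansion_deriv J (Suc n) u\<bar> \<le> C * (1 + ln u) ^ n / u ^ Suc J"
        using C(2)[of u] u by simp
    qed (use u B in auto)
  qed (use that in blast)
  have "b \<ge> 1" using b by simp
  \<comment> \<open>The differential argument leaves the constant c open; the Laplace transforms
    settle it.\<close>
  obtain B' where "\<And>u. u > 0 \<Longrightarrow> \<bar>K (Suc n) u - log_poly (Suc n) (ln u) - c\<bar> \<le> B' * u powr (- 1 / 2)"
    using K_minus_log_poly_bound [OF \<open>b \<ge> 1\<close> C'(1), of "Suc n" J c n] C'(2) unfolding R_def by blast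
  hence "c = 0" by (rule constant_eq_0)
  \<comment> \<open>The error found has only n logarithms; one more is conceded to match the claimed
    form.\<close>
  have R_bound: "\<bar>R u\<bar> \<le> C' * (1 + ln u) ^ Suc n / u ^ Suc J" if "u \<ge> b" for u
  proof -
    have "\<bar>R u\<bar> \<le> C' * (1 + ln u) ^ n / u ^ Suc J" using C'(2)[OF that] \<open>c = 0\<close> by simp
    also have "\<dots> \<le> C' * (1 + ln u) ^ Suc n / u ^ Suc J"
      using that \<open>b \<ge> 1\<close> by (intro divide_right_mono mult_left_mono power_increasing C'(1)) auto
    finally show ?thesis .
  qed
  have cont: "continuous_on {real (Suc n)..b} R"
  proof -
    have "continuous_on {real (Suc n)..b} (K (Suc n))"
      using continuous_on_subset [OF continuous_on_delay_K [of "Suc n"], of "{real (Suc n)..b}"]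
      by (simp add: K_eq_delay_K del: delay_K.simps cong: continuous_on_cong)
    moreover have "continuous_on {real (Suc n)..b} (expansion J (Suc n))"
      by (rule DERIV_continuous_on, rule has_field_derivative_at_within, rule has_real_derivative_expansion) auto
    ultimately show ?thesis unfolding R_def by (rule continuous_on_diff)
  qed
  \<comment> \<open>Compactness carries the bound from b back down to \<open>Suc n\<close>.\<close>
  obtain B'' where "B'' \<ge> 0"
    "\<And>u. u \<ge> real (Suc n) \<Longrightarrow> \<bar>R u\<bar> \<le> B'' * (1 + ln u) ^ Suc n / u ^ Suc J"
    using bound_extends_to_compact [OF _ cont C'(1) R_bound] by auto
  thus ?case unfolding R_def by blast
qed

theorem theorem1:
  fixes J l :: nat
  assumes "l \<ge> 1"
  shows "\<exists>M. \<forall>u::real. u \<ge> real l \<longrightarrow>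
    \<bar>K l u - (\<Sum>j\<le>J. \<Sum>m\<le>l. \<Sum>r\<le>l-m.
        (-1) ^ r / (fact m * fact (l - m - r)) * E j m * Cc r *
        (deriv ^^ j) (\<lambda>x. ln x ^ (l - m - r)) u)\<bar>
      \<le> M * ln (exp 1 * u) ^ l / u ^ (J + 1)"
proof -
  \<comment> \<open>The sum over r is collected in \<open>log_poly_deriv\<close>.\<close>
  have sum_eq: "(\<Sum>j\<le>J. \<Sum>m\<le>l. \<Sum>r\<le>l-m.
        (-1) ^ r / (fact m * fact (l - m - r)) * E j m * Cc r *
        (deriv ^^ j) (\<lambda>x. ln x ^ (l - m - r)) u) = expansion J l u" for u
    unfolding expansion_def log_poly_deriv_def sum_distrib_left
    by (intro sum.cong refl) (simp add: field_simps)
  obtain B where B: "\<And>u. u \<ge> 1 \<Longrightarrow> u \<ge> real l \<Longrightarrow> \<bar>K l u - expansion J l u\<bar> \<le> B * (1 + ln u) ^ l / u ^ Suc J"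
    using K_expansion by blast
  show ?thesis
    unfolding sum_eq
  proof (intro exI allI impI)
    fix u assume u: "u \<ge> real l"
    hence "u \<ge> 1" using assms by simp
    thus "\<bar>K l u - expansion J l u\<bar> \<le> B * ln (exp 1 * u) ^ l / u ^ (J + 1)"
      using B[of u] u by (simp add: ln_mult)
  qed
qed

end
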